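(* Let $X$ be a Banach space and $1\le p<+\infty$. For $U:\mathbb{R}\to L^p(0,1;X)$ define $LU:\mathbb{R}\to X$ by $LU(t)=U([t])(\{t\})$ for (a.e.) $t\in\mathbb{R}$, and let $B$ denote the Bochner transform $Bu=u^b$. (i) The map $L:BC(\mathbb{R},L^p(0,1;X))\to BS^p(\mathbb{R},X)$ is a left inverse of $B:BS^p(\mathbb{R},X)\to BC(\mathbb{R},L^p(0,1;X))$. Moreover $\mathrm{Im}(B):=B(BS^p(\mathbb{R},X))$ and $M=\{V\in BC(\mathbb{R},L^p(0,1;X)):\forall n\in\mathbb{Z},\ V(n)=0\}$ are two closed subspaces of $BC(\mathbb{R},L^p(0,1;X))$ and $BC(\mathbb{R},L^p(0,1;X))=\mathrm{Im}(B)\oplus M$. (ii) The map $L:AA(\mathbb{R},L^p(0,1;X))\to S^p_{aa}(\mathbb{R},X)$ is a left inverse of $B:S^p_{aa}(\mathbb{R},X)\to AA(\mathbb{R},L^p(0,1;X))$. Moreover $\mathrm{Im}(B):=B(S^p_{aa}(\mathbb{R},X))$ and $M=\{V\in AA(\mathbb{R},L^p(0,1;X)):\forall n\in\mathbb{Z},\ V(n)=0\}$ are two closed subspaces of $AA(\mathbb{R},L^p(0,1;X))$ and $AA(\mathbb{R},L^p(0,1;X))=\mathrm{Im}(B)\oplus M$. (iii) The map $L:AP(\mathbb{R},L^p(0,1;X))\to S^p_{ap}(\mathbb{R},X)$ is a left inverse of $B:S^p_{ap}(\mathbb{R},X)\to AP(\mathbb{R},L^p(0,1;X))$. Moreover $\mathrm{Im}(B):=B(S^p_{ap}(\mathbb{R},X))$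 and $M=\{V\in AP(\mathbb{R},L^p(0,1;X)):\forall n\in\mathbb{Z},\ V(n)=0\}$ are two closed subspaces of $AP(\mathbb{R},L^p(0,1;X))$ and $AP(\mathbb{R},L^p(0,1;X))=\mathrm{Im}(B)\oplus M$.
   Context: For $t\in\mathbb{R}$, $[t]\in\mathbb{Z}$ is the integer part and $\{t\}\in[0,1)$ the fractional part, $t=[t]+\{t\}$. For Banach spaces $E,F$ and a bounded linear operator $B:E\to F$, a left inverse of $B$ is a bounded linear operator $L:F\to E$ with $L\circ B=I_E$. For a Banach space $E$: $L^p(a,b;E)$ is the space of Bochner $p$-integrable functions on $(a,b)$ (functions equal a.e. are identified), and $L^p_{loc}(\mathbb{R},E)$ is the space of functions $u:\mathbb{R}\to E$ whose restriction to every bounded interval is in $L^p$ of that interval. The Bochner transform of $u\in L^p_{loc}(\mathbb{R},E)$ is the (continuous) map $u^b:\mathbb{R}\to L^p(0,1;E)$, $u^b(t)(\theta)=u(t+\theta)$, $\theta\in(0,1)$. $BC(\mathbb{R},E)$ is the Banach space of bounded continuous maps $\mathbb{R}\to E$ with the supremum norm. A continuous function $u:\mathbb{R}\to E$ is almost periodic (in the sense of Bohr) if for each $\varepsilon>0$ the set $\{\tau\in\mathbb{R}:\sup_{t\in\mathbb{R}}\|u(t+\tau)-u(t)\|\le\varepsilon\}$ is relatively dense in $\mathbb{R}$ (meets every interval of some fixed length); the space of such functions is $AP(\mathbb{R},E)$. A continuous function $u:\mathbb{R}\to E$ is almost automorphic if every sequence of real numbers has a subsequence $(t_k)$ for which there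 is a function $v:\mathbb{R}\to E$ with $\lim_k u(t+t_k)=v(t)$ and $\lim_k v(t-t_k)=u(t)$ for every $t\in\mathbb{R}$; the space of such functions is $AA(\mathbb{R},E)$. Both are closed subspaces of $BC(\mathbb{R},E)$. $BS^p(\mathbb{R},E)$, $S^p_{aa}(\mathbb{R},E)$, $S^p_{ap}(\mathbb{R},E)$ are the spaces of $u\in L^p_{loc}(\mathbb{R},E)$ such that $u^b$ belongs to $BC(\mathbb{R},L^p(0,1;E))$, $AA(\mathbb{R},L^p(0,1;E))$, $AP(\mathbb{R},L^p(0,1;E))$ respectively; they are Banach spaces with the norm $\|u\|_{S^p}=\sup_{t\in\mathbb{R}}\left(\int_0^1\|u(t+\theta)\|^p\,d\theta\right)^{1/p}$. *)

theory Defs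
  imports "HOL-Analysis.Analysis" "HOL-Library.Function_Algebras"
begin

section \<open>Normed spaces on a carrier\<close>

text \<open>The exponent of a Lebesgue space is a parameter, so the Lebesgue spaces and the function
  spaces over them cannot be types. A normed space is given by a carrier \<open>E\<close> inside a
  vector space and a function \<open>N\<close> that is a norm on \<open>E\<close>.\<close>

instantiation "fun" :: (type, scaleR) scaleR
begin
definition "c *\<^sub>R f = (\<lambda>x. c *\<^sub>R f x)"
instance ..
end

lemma scaleR_fun_apply [simp]: "(c *\<^sub>R f) x = c *\<^sub>R f x"
  by (simp add: scaleR_fun_def)

instance "fun" :: (type, real_vector) real_vector
  by standard (auto simp: fun_eq_iff algebra_simps)

locale normed_carrier =
  fixes E :: "'e::real_vector set" and N :: "'e \<Rightarrow> real"
  assumes subspace: "subspace E"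
    and norm_nonneg: "x \<in> E \<Longrightarrow> 0 \<le> N x"
    and norm_eq_0: "x \<in> E \<Longrightarrow> N x = 0 \<longleftrightarrow> x = 0"
    and norm_triangle: "x \<in> E \<Longrightarrow> y \<in> E \<Longrightarrow> N (x + y) \<le> N x + N y"
    and norm_scale: "x \<in> E \<Longrightarrow> N (c *\<^sub>R x) = \<bar>c\<bar> * N x"

text \<open>The guard is needed because \<^const>\<open>Metric_space\<close> asks for nonnegativity and symmetry
  off the carrier as well, where \<open>N\<close> need not behave like a norm.\<close>

definition norm_dist :: "'e::real_vector set \<Rightarrow> ('e \<Rightarrow> real) \<Rightarrow> 'e \<Rightarrow> 'e \<Rightarrow> real" where
  "norm_dist E N x y = (if x \<in> E \<and> y \<in> E then N (x - y) else 0)"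

definition norm_metric :: "'e::real_vector set \<Rightarrow> ('e \<Rightarrow> real) \<Rightarrow> 'e metric" where
  "norm_metric E N = metric (E, norm_dist E N)"

lemma (in normed_carrier) Metric_space_norm_dist: "Metric_space E (norm_dist E N)"
proof
  fix x y z
  have diff: "a - b \<in> E" if "a \<in> E" "b \<in> E" for a b
    using subspace_diff[OF subspace that] .
  show "0 \<le> norm_dist E N x y"
    by (auto simp: norm_dist_def intro!: norm_nonneg diff)
  show "norm_dist E N x y = norm_dist E N y x"
    using norm_scale[of "x - y" "-1"] diff by (auto simp: norm_dist_def)
  show "norm_dist E N x y = 0 \<longleftrightarrow> x = y" if "x \<in> E" "y \<in> E"
    using that by (auto simp: norm_dist_def norm_eq_0 diff)
  show "norm_dist E N x z \<le> norm_dist E N x y + norm_dist E N y z"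
    if "x \<in> E" "y \<in> E" "z \<in> E"
    using that norm_triangle[of "x - y" "y - z"] by (auto simp: norm_dist_def diff)
qed

lemma (in normed_carrier) mspace_norm_metric [simp]: "mspace (norm_metric E N) = E"
  and mdist_norm_metric [simp]: "mdist (norm_metric E N) = norm_dist E N"
  using Metric_space_norm_dist
  by (simp_all add: norm_metric_def Metric_space.mspace_metric Metric_space.mdist_metric)

definition closed_subspace ::
    "'e::real_vector set \<Rightarrow> ('e \<Rightarrow> real) \<Rightarrow> 'e set \<Rightarrow> bool" where
  "closed_subspace E N S \<longleftrightarrow>
     subspace S \<and> S \<subseteq> E \<and> closedin (mtopology_of (norm_metric E N)) S"

definition direct_sum :: "'e::real_vector set \<Rightarrow> 'e set \<Rightarrow> 'e set \<Rightarrow> bool" where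
  "direct_sum E S T \<longleftrightarrow> E = {x + y | x y. x \<in> S \<and> y \<in> T} \<and> S \<inter> T = {0}"

definition bounded_operator ::
    "'e::real_vector set \<Rightarrow> ('e \<Rightarrow> real) \<Rightarrow> 'f::real_vector set \<Rightarrow> ('f \<Rightarrow> real)
      \<Rightarrow> ('e \<Rightarrow> 'f) \<Rightarrow> bool" where
  "bounded_operator E NE F NF T \<longleftrightarrow>
     T ` E \<subseteq> F \<and>
     (\<forall>x\<in>E. \<forall>y\<in>E. T (x + y) = T x + T y) \<and>
     (\<forall>c. \<forall>x\<in>E. T (c *\<^sub>R x) = c *\<^sub>R T x) \<and>
     (\<exists>K. \<forall>x\<in>E. NF (T x) \<le> K * NE x)"

definition left_inverse ::
    "'e::real_vector set \<Rightarrow> ('e \<Rightarrow> real) \<Rightarrow> 'f::real_vector set \<Rightarrow> ('f \<Rightarrow> real)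
      \<Rightarrow> ('e \<Rightarrow> 'f) \<Rightarrow> ('f \<Rightarrow> 'e) \<Rightarrow> bool" where
  "left_inverse E NE F NF B L \<longleftrightarrow>
     bounded_operator E NE F NF B \<and> bounded_operator F NF E NE L \<and> (\<forall>x\<in>E. L (B x) = x)"


section \<open>Bounded continuous, almost periodic and almost automorphic functions\<close>

definition sup_norm :: "('e \<Rightarrow> real) \<Rightarrow> (real \<Rightarrow> 'e) \<Rightarrow> real" where
  "sup_norm N u = (SUP t. N (u t))"

definition BC :: "'e::real_vector set \<Rightarrow> ('e \<Rightarrow> real) \<Rightarrow> (real \<Rightarrow> 'e) set" where
  "BC E N = mspace (cfunspace euclideanreal (norm_metric E N))"

definition relatively_dense :: "real set \<Rightarrow> bool" where
  "relatively_dense P \<longleftrightarrow> (\<exists>l>0. \<forall>a. P \<inter> {a..a + l} \<noteq> {})"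

definition AP :: "'e::real_vector set \<Rightarrow> ('e \<Rightarrow> real) \<Rightarrow> (real \<Rightarrow> 'e) set" where
  "AP E N = {u. continuous_map euclideanreal (mtopology_of (norm_metric E N)) u \<and>
     (\<forall>\<epsilon>>0. relatively_dense {\<tau>. \<forall>t. N (u (t + \<tau>) - u t) \<le> \<epsilon>})}"

definition AA :: "'e::real_vector set \<Rightarrow> ('e \<Rightarrow> real) \<Rightarrow> (real \<Rightarrow> 'e) set" where
  "AA E N = {u. continuous_map euclideanreal (mtopology_of (norm_metric E N)) u \<and>
     (\<forall>s :: nat \<Rightarrow> real. \<exists>r :: nat \<Rightarrow> nat. strict_mono r \<and>
       (\<exists>v. \<forall>t.
          limitin (mtopology_of (norm_metric E N)) (\<lambda>k. u (t + s (r k))) (v t) sequentially \<and>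
          limitin (mtopology_of (norm_metric E N)) (\<lambda>k. v (t - s (r k))) (u t) sequentially))}"

lemma (in normed_carrier) BC_iff:
  "u \<in> BC E N \<longleftrightarrow> range u \<subseteq> E \<and>
     continuous_map euclideanreal (mtopology_of (norm_metric E N)) u \<and> (\<exists>K. \<forall>t. N (u t) \<le> K)"
proof -
  interpret M: Metric_space E "norm_dist E N"
    by (rule Metric_space_norm_dist)
  have bdd: "M.mbounded (range u) \<longleftrightarrow> (\<exists>K. \<forall>t. N (u t) \<le> K)" if u: "range u \<subseteq> E"
  proof
    have 0: "0 \<in> E" by (rule subspace_0[OF subspace])
    show "M.mbounded (range u)" if ex: "\<exists>K. \<forall>t. N (u t) \<le> K"
    proof -
      obtain K where K: "\<And>t. N (u t) \<le> K" using ex by blast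
      have "norm_dist E N 0 (u t) \<le> K" for t
        using u 0 K[of t] norm_scale[of "u t" "-1"] by (auto simp: norm_dist_def)
      then show ?thesis
        using u 0 by (auto simp: M.mbounded_def M.mcball_def intro!: exI[of _ 0] exI[of _ K])
    qed
    show "\<exists>K. \<forall>t. N (u t) \<le> K" if b: "M.mbounded (range u)"
    proof -
      have "M.mbounded (insert 0 (range u))"
        using b 0 by (simp add: M.mbounded_insert)
      then obtain K where "\<forall>x\<in>insert 0 (range u). \<forall>y\<in>insert 0 (range u). norm_dist E N x y \<le> K"
        unfolding M.mbounded_alt by blast
      then have K: "norm_dist E N (u t) 0 \<le> K" for t
        by blast
      then have "N (u t) \<le> K" for t
        using u 0 K[of t] by (auto simp: norm_dist_def image_subset_iff)
      then show ?thesis by blast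
    qed
  qed
  show ?thesis
    using bdd by (auto simp: BC_def image_subset_iff)
qed


lemma (in normed_carrier) normed_carrier_BC: "normed_carrier (BC E N) (sup_norm N)"
proof -
  interpret M: Metric_space E "norm_dist E N"
    by (rule Metric_space_norm_dist)
  have mtop: "mtopology_of (norm_metric E N) = M.mtopology"
    by (simp add: mtopology_of_def)
  have cont: "continuous_map euclideanreal (mtopology_of (norm_metric E N)) u \<longleftrightarrow>
      (\<forall>t. \<forall>e>0. \<exists>d>0. \<forall>s. \<bar>s - t\<bar> < d \<longrightarrow> N (u s - u t) < e)" if "range u \<subseteq> E" for u :: "real \<Rightarrow> 'e"
  proof -
    have "continuous_map euclideanreal (mtopology_of (norm_metric E N)) u \<longleftrightarrow>
      continuous_map Met_TC.mtopology M.mtopology u" by (simp add: mtop)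
    also have "\<dots> \<longleftrightarrow> (\<forall>t. \<forall>e>0. \<exists>d>0. \<forall>s. \<bar>s - t\<bar> < d \<longrightarrow> N (u s - u t) < e)"
    proof -
      have [simp]: "norm_dist E N (u t) (u s) = N (u s - u t)" for s t
        using that by (subst M.commute) (auto simp: norm_dist_def)
      show ?thesis
        using that
        by (subst Met_TC.metric_continuous_map[OF Metric_space_norm_dist])
          (auto simp: image_subset_iff dist_real_def abs_minus_commute)
    qed
    finally show ?thesis .
  qed
  have sub: "a + b \<in> E" "c *\<^sub>R a \<in> E" "a - b \<in> E" if "a \<in> E" "b \<in> E" for a b c
    using that subspace by (auto intro: subspace_add subspace_scale subspace_diff)
  have BC: "u \<in> BC E N \<longleftrightarrow> range u \<subseteq> E \<and>
      (\<forall>t. \<forall>e>0. \<exists>d>0. \<forall>s. \<bar>s - t\<bar> < d \<longrightarrow> N (u s - u t) < e) \<and> (\<exists>K. \<forall>t. N (u t) \<le> K)" for u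
    using cont[of u] by (auto simp: BC_iff)
  have add: "u + v \<in> BC E N" if u: "u \<in> BC E N" and v: "v \<in> BC E N" for u v
  proof -
    have mem: "u t \<in> E" "v t \<in> E" for t
      using u v by (auto simp: BC)
    obtain K L where K: "\<And>t. N (u t) \<le> K" "\<And>t. N (v t) \<le> L"
      using u v by (auto simp: BC)
    have "\<exists>d>0. \<forall>s. \<bar>s - t\<bar> < d \<longrightarrow> N ((u + v) s - (u + v) t) < e" if "0 < e" for t e
    proof -
      have "0 < e / 2" using that by simp
      then obtain d1 d2 where d: "0 < d1" "\<And>s. \<bar>s - t\<bar> < d1 \<Longrightarrow> N (u s - u t) < e / 2"
        "0 < d2" "\<And>s. \<bar>s - t\<bar> < d2 \<Longrightarrow> N (v s - v t) < e / 2"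
        using u v unfolding BC by blast
      have "N ((u + v) s - (u + v) t) < e" if "\<bar>s - t\<bar> < min d1 d2" for s
      proof -
        have "N ((u + v) s - (u + v) t) = N ((u s - u t) + (v s - v t))"
          by (simp add: algebra_simps)
        also have "\<dots> \<le> N (u s - u t) + N (v s - v t)"
          by (intro norm_triangle sub mem)
        also have "\<dots> < e"
          using d(2)[of s] d(4)[of s] that by simp
        finally show ?thesis .
      qed
      then show ?thesis
        using d(1,3) by (intro exI[of _ "min d1 d2"]) auto
    qed
    moreover have "N ((u + v) t) \<le> K + L" for t
      using norm_triangle[OF mem, of t t] K[of t] by simp
    ultimately show ?thesis
      unfolding BC using mem by (auto intro!: sub exI[of _ "K + L"])
  qed
  have scale: "c *\<^sub>R u \<in> BC E N" if u: "u \<in> BC E N" for c u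
  proof -
    have mem: "u t \<in> E" for t
      using u by (auto simp: BC)
    obtain K where K: "\<And>t. N (u t) \<le> K"
      using u by (auto simp: BC)
    have "\<exists>d>0. \<forall>s. \<bar>s - t\<bar> < d \<longrightarrow> N ((c *\<^sub>R u) s - (c *\<^sub>R u) t) < e" if "0 < e" for t e
    proof -
      have "0 < e / (\<bar>c\<bar> + 1)" using that by simp
      then obtain d where d: "0 < d" "\<And>s. \<bar>s - t\<bar> < d \<Longrightarrow> N (u s - u t) < e / (\<bar>c\<bar> + 1)"
        using u unfolding BC by blast
      have "N ((c *\<^sub>R u) s - (c *\<^sub>R u) t) < e" if "\<bar>s - t\<bar> < d" for s
      proof -
        have "N ((c *\<^sub>R u) s - (c *\<^sub>R u) t) = \<bar>c\<bar> * N (u s - u t)"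
          using norm_scale[of "u s - u t" c] sub mem by (simp add: scaleR_diff_right)
        also have "\<dots> \<le> (\<bar>c\<bar> + 1) * N (u s - u t)"
          by (intro mult_right_mono norm_nonneg sub mem) simp
        also have "\<dots> < e"
          using d(2)[OF that] by (simp add: pos_less_divide_eq mult.commute)
        finally show ?thesis .
      qed
      then show ?thesis using d(1) by blast
    qed
    moreover have "N ((c *\<^sub>R u) t) \<le> \<bar>c\<bar> * K" for t
      using norm_scale[OF mem[of t], of c] K[of t] by (simp add: mult_left_mono)
    ultimately show ?thesis
      unfolding BC using mem by (auto intro!: sub exI[of _ "\<bar>c\<bar> * K"])
  qed
  have 0: "0 \<in> BC E N"
    unfolding BC using subspace_0[OF subspace] norm_eq_0[of 0]
    by (auto intro: exI[of _ 0] exI[of _ 1])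
  have mem: "u t \<in> E" if "u \<in> BC E N" for u t
    using that by (auto simp: BC)
  have bdd: "bdd_above (range (\<lambda>t. N (u t)))" if "u \<in> BC E N" for u
    using that by (auto simp: BC bdd_above_def)
  have le: "N (u t) \<le> sup_norm N u" if "u \<in> BC E N" for u t
    unfolding sup_norm_def by (rule cSUP_upper[OF UNIV_I bdd[OF that]])
  have least: "sup_norm N u \<le> K" if "\<And>t. N (u t) \<le> K" for u K
    unfolding sup_norm_def using that by (intro cSUP_least) auto
  show ?thesis
  proof
    show "subspace (BC E N)"
      by (simp add: subspace_def 0 add scale)
    fix u v c
    assume u: "u \<in> BC E N"
    show nonneg: "0 \<le> sup_norm N u"
      using norm_nonneg[OF mem[OF u]] le[OF u] order_trans by blast
    show "sup_norm N u = 0 \<longleftrightarrow> u = 0"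
    proof
      assume "sup_norm N u = 0"
      then have "N (u t) = 0" for t
        using le[OF u, of t] norm_nonneg[OF mem[OF u], of t] by simp
      then show "u = 0"
        using norm_eq_0[OF mem[OF u]] by (simp add: fun_eq_iff)
    next
      assume "u = 0"
      then show "sup_norm N u = 0"
        using norm_eq_0[of 0] subspace_0[OF subspace] by (simp add: sup_norm_def)
    qed
    show "sup_norm N (c *\<^sub>R u) = \<bar>c\<bar> * sup_norm N u"
    proof (rule antisym)
      have N: "N ((c *\<^sub>R u) t) = \<bar>c\<bar> * N (u t)" for t
        using norm_scale[OF mem[OF u]] by simp
      show "sup_norm N (c *\<^sub>R u) \<le> \<bar>c\<bar> * sup_norm N u"
        by (rule least) (simp only: N mult_left_mono le[OF u] abs_ge_zero)
      show "\<bar>c\<bar> * sup_norm N u \<le> sup_norm N (c *\<^sub>R u)"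
      proof (cases "c = 0")
        case True
        then show ?thesis
          using norm_eq_0[of 0] subspace_0[OF subspace] by (simp add: sup_norm_def)
      next
        case False
        have "sup_norm N u \<le> sup_norm N (c *\<^sub>R u) / \<bar>c\<bar>"
          using le[OF scale[OF u, of c]] False N
          by (intro least) (simp add: pos_le_divide_eq mult.commute)
        then show ?thesis
          using False by (simp add: pos_le_divide_eq mult.commute)
      qed
    qed
    assume v: "v \<in> BC E N"
    show "sup_norm N (u + v) \<le> sup_norm N u + sup_norm N v"
    proof (rule least)
      fix t
      show "N ((u + v) t) \<le> sup_norm N u + sup_norm N v"
        using norm_triangle[OF mem[OF u, of t] mem[OF v, of t]] le[OF u, of t] le[OF v, of t]
        by simp
    qed
  qed
qed


section \<open>Strong measurability and Bochner integrable powers\<close>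

text \<open>The target space need not be separable, so Borel measurability would not suffice.\<close>

definition strongly_measurable :: "'b measure \<Rightarrow> ('b \<Rightarrow> 'a::real_normed_vector) \<Rightarrow> bool" where
  "strongly_measurable M f \<longleftrightarrow>
     (\<exists>s. (\<forall>i. simple_function M (s i)) \<and> (AE x in M. (\<lambda>i. s i x) \<longlonglongrightarrow> f x))"

definition Bochner_p_integrable ::
    "'b measure \<Rightarrow> real \<Rightarrow> ('b \<Rightarrow> 'a::real_normed_vector) \<Rightarrow> bool" where
  "Bochner_p_integrable M p f \<longleftrightarrow>
     strongly_measurable M f \<and> integrable M (\<lambda>x. norm (f x) powr p)"

lemma strongly_measurable_AE_cong:
  assumes "AE x in M. f x = g x" "strongly_measurable M f"
  shows "strongly_measurable M g"
proof -
  obtain s where s: "\<And>i. simple_function M (s i)" "AE x in M. (\<lambda>i. s i x) \<longlonglongrightarrow> f x"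
    using assms(2) by (auto simp: strongly_measurable_def)
  have "AE x in M. (\<lambda>i. s i x) \<longlonglongrightarrow> g x"
    using assms(1) s(2) by eventually_elim simp
  with s(1) show ?thesis
    by (auto simp: strongly_measurable_def)
qed

lemma strongly_measurable_add:
  assumes "strongly_measurable M f" "strongly_measurable M g"
  shows "strongly_measurable M (\<lambda>x. f x + g x)"
proof -
  obtain s where s: "\<And>i. simple_function M (s i)" "AE x in M. (\<lambda>i. s i x) \<longlonglongrightarrow> f x"
    using assms(1) by (auto simp: strongly_measurable_def)
  obtain r where r: "\<And>i. simple_function M (r i)" "AE x in M. (\<lambda>i. r i x) \<longlonglongrightarrow> g x"
    using assms(2) by (auto simp: strongly_measurable_def)
  have "AE x in M. (\<lambda>i. s i x + r i x) \<longlonglongrightarrow> f x + g x"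
    using s(2) r(2) by eventually_elim (rule tendsto_add)
  then show ?thesis
    using s(1) r(1) unfolding strongly_measurable_def
    by (intro exI[of _ "\<lambda>i x. s i x + r i x"]) (auto intro: simple_function_compose2[where h="(+)"])
qed

lemma strongly_measurable_scaleR:
  assumes "strongly_measurable M f"
  shows "strongly_measurable M (\<lambda>x. c *\<^sub>R f x)"
proof -
  obtain s where s: "\<And>i. simple_function M (s i)" "AE x in M. (\<lambda>i. s i x) \<longlonglongrightarrow> f x"
    using assms by (auto simp: strongly_measurable_def)
  have "AE x in M. (\<lambda>i. c *\<^sub>R s i x) \<longlonglongrightarrow> c *\<^sub>R f x"
    using s(2) by eventually_elim (intro tendsto_intros)
  then show ?thesis
    using s(1) unfolding strongly_measurable_def
    by (intro exI[of _ "\<lambda>i x. c *\<^sub>R s i x"])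
      (auto intro: simple_function_compose1[where g="\<lambda>y. c *\<^sub>R y"])
qed

lemma complete_measure_lebesgue_on:
  assumes "S \<in> sets lebesgue"
  shows "complete_measure (lebesgue_on S)"
proof
  fix A B assume "B \<subseteq> A" "A \<in> null_sets (lebesgue_on S)"
  then have "A \<subseteq> S" "A \<in> null_sets lebesgue"
    using assms by (simp_all add: null_sets_restrict_space)
  then have "B \<in> sets lebesgue" "B \<subseteq> S"
    using \<open>B \<subseteq> A\<close> completion.complete by blast+
  then show "B \<in> sets (lebesgue_on S)"
    using assms by (simp add: sets_restrict_space_iff)
qed

lemma (in complete_measure) borel_measurable_AE_cong:
  assumes "AE x in M. f x = g x" "f \<in> borel_measurable M"
  shows "g \<in> borel_measurable M"
proof (rule measurableI)
  fix A :: "'b set" assume A: "A \<in> sets borel"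
  show "g -` A \<inter> space M \<in> sets M"
  proof (rule in_sets_AE)
    show "AE x in M. x \<in> f -` A \<inter> space M \<longleftrightarrow> x \<in> g -` A \<inter> space M"
      using assms(1) by eventually_elim auto
  qed (use assms(2) A in \<open>auto intro: measurable_sets\<close>)
qed simp

lemma (in complete_measure) strongly_measurable_norm:
  assumes "strongly_measurable M f"
  shows "(\<lambda>x. norm (f x)) \<in> borel_measurable M"
proof -
  obtain s where s: "\<And>i. simple_function M (s i)" "AE x in M. (\<lambda>i. s i x) \<longlonglongrightarrow> f x"
    using assms by (auto simp: strongly_measurable_def)
  have m: "(\<lambda>x. norm (s i x)) \<in> borel_measurable M" for i
    by (rule borel_measurable_simple_function) (rule simple_function_compose1[OF s(1)])
  have "AE x in M. lim (\<lambda>i. norm (s i x)) = norm (f x)"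
    using s(2) by eventually_elim (intro limI tendsto_norm)
  then show ?thesis
    by (rule borel_measurable_AE_cong) (intro borel_measurable_lim_metric m)
qed

lemma (in complete_measure) integral_AE_cong_complete:
  fixes f g :: "'a \<Rightarrow> real"
  assumes "AE x in M. f x = g x"
  shows "integrable M f \<longleftrightarrow> integrable M g" "integral\<^sup>L M f = integral\<^sup>L M g"
proof -
  have eq: "f \<in> borel_measurable M \<longleftrightarrow> g \<in> borel_measurable M"
  proof
    have "AE x in M. g x = f x" using assms by eventually_elim simp
    then show "g \<in> borel_measurable M \<Longrightarrow> f \<in> borel_measurable M"
      by (rule borel_measurable_AE_cong)
  qed (rule borel_measurable_AE_cong[OF assms])
  show "integrable M f \<longleftrightarrow> integrable M g"
    using eq integrable_cong_AE[OF _ _ assms] borel_measurable_integrable by blast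
  show "integral\<^sup>L M f = integral\<^sup>L M g"
  proof (cases "f \<in> borel_measurable M")
    case True
    then show ?thesis using eq integral_cong_AE[OF _ _ assms] by blast
  next
    case False
    then have "\<not> integrable M f" "\<not> integrable M g"
      using eq borel_measurable_integrable by blast+
    then show ?thesis by (simp add: not_integrable_integral_eq)
  qed
qed

lemma (in complete_measure) Bochner_p_integrable_AE_cong:
  assumes "AE x in M. f x = g x"
  shows "Bochner_p_integrable M p f \<longleftrightarrow> Bochner_p_integrable M p g"
proof -
  have sym: "AE x in M. g x = f x"
    using assms by eventually_elim simp
  have "AE x in M. norm (f x) powr p = norm (g x) powr p"
    using assms by eventually_elim simp
  from integral_AE_cong_complete(1)[OF this] show ?thesis
    using strongly_measurable_AE_cong[OF assms] strongly_measurable_AE_cong[OF sym]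
    by (auto simp: Bochner_p_integrable_def)
qed


section \<open>Functions up to almost everywhere equality\<close>

text \<open>Classes on \<open>(0,1)\<close> and on \<open>\<real>\<close>. No measurability is built into the types;
  it is part of the definitions of the carriers below.\<close>

quotient_type (overloaded) 'a ae01 =
  "real \<Rightarrow> 'a::real_normed_vector" / "\<lambda>f g. AE x in lebesgue_on {0<..<1}. f x = g x"
proof (rule equivpI)
  show "reflp (\<lambda>f g :: real \<Rightarrow> 'a. AE x in lebesgue_on {0<..<1}. f x = g x)"
    by (auto intro: reflpI)
  show "symp (\<lambda>f g :: real \<Rightarrow> 'a. AE x in lebesgue_on {0<..<1}. f x = g x)"
    by (rule sympI) (auto elim: eventually_mono)
  show "transp (\<lambda>f g :: real \<Rightarrow> 'a. AE x in lebesgue_on {0<..<1}. f x = g x)"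
    by (rule transpI) (erule (1) eventually_elim2, simp)
qed

quotient_type (overloaded) 'a aeR =
  "real \<Rightarrow> 'a::real_normed_vector" / "\<lambda>f g. AE x in lebesgue. f x = g x"
proof (rule equivpI)
  show "reflp (\<lambda>f g :: real \<Rightarrow> 'a. AE x in lebesgue. f x = g x)"
    by (auto intro: reflpI)
  show "symp (\<lambda>f g :: real \<Rightarrow> 'a. AE x in lebesgue. f x = g x)"
    by (rule sympI) (auto elim: eventually_mono)
  show "transp (\<lambda>f g :: real \<Rightarrow> 'a. AE x in lebesgue. f x = g x)"
    by (rule transpI) (erule (1) eventually_elim2, simp)
qed

instantiation ae01 :: (real_normed_vector) real_vector
begin
lift_definition zero_ae01 :: "'a ae01" is "\<lambda>_. 0" .
lift_definition plus_ae01 :: "'a ae01 \<Rightarrow> 'a ae01 \<Rightarrow> 'a ae01" is "\<lambda>f g x. f x + g x"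
  by (erule (1) eventually_elim2) simp
lift_definition minus_ae01 :: "'a ae01 \<Rightarrow> 'a ae01 \<Rightarrow> 'a ae01" is "\<lambda>f g x. f x - g x"
  by (erule (1) eventually_elim2) simp
lift_definition uminus_ae01 :: "'a ae01 \<Rightarrow> 'a ae01" is "\<lambda>f x. - f x"
  by (elim eventually_mono) simp
lift_definition scaleR_ae01 :: "real \<Rightarrow> 'a ae01 \<Rightarrow> 'a ae01" is "\<lambda>c f x. c *\<^sub>R f x"
  by (elim eventually_mono) simp
instance
  by standard (transfer; simp add: algebra_simps)+
end

instantiation aeR :: (real_normed_vector) real_vector
begin
lift_definition zero_aeR :: "'a aeR" is "\<lambda>_. 0" .
lift_definition plus_aeR :: "'a aeR \<Rightarrow> 'a aeR \<Rightarrow> 'a aeR" is "\<lambda>f g x. f x + g x"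
  by (erule (1) eventually_elim2) simp
lift_definition minus_aeR :: "'a aeR \<Rightarrow> 'a aeR \<Rightarrow> 'a aeR" is "\<lambda>f g x. f x - g x"
  by (erule (1) eventually_elim2) simp
lift_definition uminus_aeR :: "'a aeR \<Rightarrow> 'a aeR" is "\<lambda>f x. - f x"
  by (elim eventually_mono) simp
lift_definition scaleR_aeR :: "real \<Rightarrow> 'a aeR \<Rightarrow> 'a aeR" is "\<lambda>c f x. c *\<^sub>R f x"
  by (elim eventually_mono) simp
instance
  by standard (transfer; simp add: algebra_simps)+
end


section \<open>Lebesgue spaces\<close>

lift_definition in_Lp :: "real \<Rightarrow> 'a::real_normed_vector ae01 \<Rightarrow> bool"
  is "Bochner_p_integrable (lebesgue_on {0<..<1})"
  by (rule complete_measure.Bochner_p_integrable_AE_cong[OF complete_measure_lebesgue_on]) auto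

definition Lp :: "real \<Rightarrow> 'a::real_normed_vector ae01 set" where
  "Lp p = {f. in_Lp p f}"

lift_definition Lp_norm :: "real \<Rightarrow> 'a::real_normed_vector ae01 \<Rightarrow> real"
  is "\<lambda>p f. (\<integral>x. norm (f x) powr p \<partial>lebesgue_on {0<..<1}) powr (1 / p)"
  by (intro arg_cong[where f="\<lambda>I. I powr _"]
      complete_measure.integral_AE_cong_complete[OF complete_measure_lebesgue_on])
    (auto elim: eventually_mono)

lift_definition in_Lp_loc :: "real \<Rightarrow> 'a::real_normed_vector aeR \<Rightarrow> bool"
  is "\<lambda>p f. \<forall>a b. a < b \<longrightarrow> Bochner_p_integrable (lebesgue_on {a<..<b}) p f"
proof -
  fix p and f g :: "real \<Rightarrow> 'a"
  assume "AE x in lebesgue. f x = g x"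
  then have "AE x in lebesgue_on {a<..<b}. f x = g x" for a b
    by (auto simp: AE_restrict_space_iff elim: eventually_mono)
  then have "Bochner_p_integrable (lebesgue_on {a<..<b}) p f \<longleftrightarrow>
      Bochner_p_integrable (lebesgue_on {a<..<b}) p g" for a b
    by (intro complete_measure.Bochner_p_integrable_AE_cong complete_measure_lebesgue_on) auto
  then show "(\<forall>a b. a < b \<longrightarrow> Bochner_p_integrable (lebesgue_on {a<..<b}) p f) \<longleftrightarrow>
      (\<forall>a b. a < b \<longrightarrow> Bochner_p_integrable (lebesgue_on {a<..<b}) p g)"
    by simp
qed


lemma powr_convex_nonneg:
  fixes x y u v p :: real
  assumes "1 \<le> p" "0 \<le> x" "0 \<le> y" "0 \<le> u" "0 \<le> v" "u + v = 1"
  shows "(u * x + v * y) powr p \<le> u * x powr p + v * y powr p"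
proof -
  have le: "(c * z) powr p \<le> c * z powr p" if "0 \<le> c" "c \<le> 1" "0 \<le> z" for c z
  proof -
    have "c powr p \<le> c"
    proof (cases "c = 0")
      case False
      then have "c powr p \<le> c powr 1" using that assms(1) by (intro powr_mono') auto
      then show ?thesis using that False by simp
    qed simp
    then show ?thesis using that by (simp add: powr_mult mult_right_mono)
  qed
  consider "x = 0" | "y = 0" | "0 < x" "0 < y"
    using assms by linarith
  then show ?thesis
  proof cases
    case 1 then show ?thesis using le[of v y] assms by simp
  next
    case 2 then show ?thesis using le[of u x] assms by simp
  next
    case 3
    have "((1 - v) *\<^sub>R x + v *\<^sub>R y) powr p \<le> (1 - v) * x powr p + v * y powr p"
      using convex_onD[OF powr_convex[OF assms(1)], of v x y] assms 3 by simp
    moreover have "1 - v = u"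
      using assms(6) by simp
    ultimately show ?thesis by simp
  qed
qed

lemma (in complete_measure) Bochner_p_Minkowski:
  fixes f g :: "'a \<Rightarrow> 'b::real_normed_vector"
  assumes p: "1 \<le> p" and f: "Bochner_p_integrable M p f" and g: "Bochner_p_integrable M p g"
  shows "Bochner_p_integrable M p (\<lambda>x. f x + g x)"
    and "(\<integral>x. norm (f x + g x) powr p \<partial>M) powr (1 / p) \<le>
      (\<integral>x. norm (f x) powr p \<partial>M) powr (1 / p) + (\<integral>x. norm (g x) powr p \<partial>M) powr (1 / p)"
proof -
  define a where "a = (\<integral>x. norm (f x) powr p \<partial>M) powr (1 / p)"
  define b where "b = (\<integral>x. norm (g x) powr p \<partial>M) powr (1 / p)"
  have If: "integrable M (\<lambda>x. norm (f x) powr p)" and Ig: "integrable M (\<lambda>x. norm (g x) powr p)"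
    and sm: "strongly_measurable M (\<lambda>x. f x + g x)"
    using f g by (auto simp: Bochner_p_integrable_def intro: strongly_measurable_add)
  have a: "0 \<le> a" "a powr p = (\<integral>x. norm (f x) powr p \<partial>M)"
    using p by (auto simp: a_def powr_powr integral_nonneg_AE)
  have b: "0 \<le> b" "b powr p = (\<integral>x. norm (g x) powr p \<partial>M)"
    using p by (auto simp: b_def powr_powr integral_nonneg_AE)
  define G where "G a' b' x = (a' + b') powr p * (a' / (a' + b') * (norm (f x) powr p / a' powr p)
      + b' / (a' + b') * (norm (g x) powr p / b' powr p))" for a' b' x
  have pt: "norm (f x + g x) powr p \<le> G a' b' x" if "0 < a'" "0 < b'" for a' b' x
  proof -
    have "(a' + b') * (a' / (a' + b') * (norm (f x) / a') + b' / (a' + b') * (norm (g x) / b'))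
        = norm (f x) + norm (g x)"
      using that by (simp add: distrib_left)
    then have "norm (f x + g x) \<le> (a' + b') * (a' / (a' + b') * (norm (f x) / a')
        + b' / (a' + b') * (norm (g x) / b'))"
      using norm_triangle_ineq[of "f x" "g x"] by simp
    then have "norm (f x + g x) powr p \<le> ((a' + b') * (a' / (a' + b') * (norm (f x) / a')
        + b' / (a' + b') * (norm (g x) / b'))) powr p"
      using p by (intro powr_mono2) auto
    also have "\<dots> = (a' + b') powr p * (a' / (a' + b') * (norm (f x) / a')
        + b' / (a' + b') * (norm (g x) / b')) powr p"
      using that by (simp add: powr_mult)
    also have "\<dots> \<le> (a' + b') powr p * (a' / (a' + b') * (norm (f x) / a') powr p
        + b' / (a' + b') * (norm (g x) / b') powr p)"
      using that p by (intro mult_left_mono powr_convex_nonneg) (auto simp: add_divide_distrib[symmetric])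
    also have "\<dots> = G a' b' x"
      using that by (simp add: G_def powr_divide)
    finally show ?thesis .
  qed
  have IG: "integrable M (G a' b')" for a' b'
    unfolding G_def using If Ig
    by (intro integrable_mult_right Bochner_Integration.integrable_add integrable_divide)
  have Ifg: "integrable M (\<lambda>x. norm (f x + g x) powr p)"
  proof (rule Bochner_Integration.integrable_bound[OF IG[of 1 1]])
    show "(\<lambda>x. norm (f x + g x) powr p) \<in> borel_measurable M"
      using strongly_measurable_norm[OF sm] by measurable
    show "AE x in M. norm (norm (f x + g x) powr p) \<le> norm (G 1 1 x)"
    proof (rule AE_I2)
      fix x
      show "norm (norm (f x + g x) powr p) \<le> norm (G 1 1 x)"
        using pt[of 1 1 x] powr_ge_zero[of "norm (f x + g x)" p] by (simp add: abs_if)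
    qed
  qed
  then show "Bochner_p_integrable M p (\<lambda>x. f x + g x)"
    using sm by (simp add: Bochner_p_integrable_def)
  have bound: "(\<integral>x. norm (f x + g x) powr p \<partial>M) powr (1 / p) \<le> a' + b'"
    if a': "a < a'" and b': "b < b'" for a' b'
  proof -
    have pos: "0 < a'" "0 < b'" using a b a' b' by linarith+
    have le: "a powr p / a' powr p \<le> 1" "b powr p / b' powr p \<le> 1"
      using powr_mono2[of p a a'] powr_mono2[of p b b'] a(1) b(1) a' b' pos p
      by (simp_all add: divide_le_eq_1)
    have "(\<integral>x. norm (f x + g x) powr p \<partial>M) \<le> integral\<^sup>L M (G a' b')"
      by (intro integral_mono Ifg IG pt pos)
    also have "\<dots> = (a' + b') powr p * (a' / (a' + b') * (a powr p / a' powr p)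
        + b' / (a' + b') * (b powr p / b' powr p))"
      unfolding G_def a b using If Ig by simp
    also have "\<dots> \<le> (a' + b') powr p * (a' / (a' + b') * 1 + b' / (a' + b') * 1)"
      using pos by (intro mult_left_mono add_mono le) auto
    also have "\<dots> = (a' + b') powr p"
      using pos by (simp add: add_divide_distrib[symmetric])
    finally have "(\<integral>x. norm (f x + g x) powr p \<partial>M) powr (1 / p) \<le> ((a' + b') powr p) powr (1 / p)"
      using p by (intro powr_mono2) (auto intro: integral_nonneg_AE)
    then show ?thesis using p pos by (simp add: powr_powr)
  qed
  have "(\<integral>x. norm (f x + g x) powr p \<partial>M) powr (1 / p) \<le> a + b + e" if "0 < e" for e
    using bound[of "a + e / 2" "b + e / 2"] that by simp
  then show "(\<integral>x. norm (f x + g x) powr p \<partial>M) powr (1 / p) \<le>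
      (\<integral>x. norm (f x) powr p \<partial>M) powr (1 / p) + (\<integral>x. norm (g x) powr p \<partial>M) powr (1 / p)"
    unfolding a_def[symmetric] b_def[symmetric] by (rule field_le_epsilon)
qed

lemma normed_carrier_Lp:
  assumes p: "1 \<le> p"
  shows "normed_carrier (Lp p :: 'a::real_normed_vector ae01 set) (Lp_norm p)"
proof -
  interpret complete_measure "lebesgue_on {0<..<1::real}"
    by (rule complete_measure_lebesgue_on) simp
  have zero: "in_Lp p (0 :: 'a ae01)"
    by transfer (auto simp: Bochner_p_integrable_def strongly_measurable_def
        intro!: exI[of _ "\<lambda>_ _. 0"])
  have add: "in_Lp p (f + g)" if "in_Lp p f" "in_Lp p g" for f g :: "'a ae01"
    using p that by transfer (rule Bochner_p_Minkowski(1))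
  have scale: "in_Lp p (c *\<^sub>R f)" if "in_Lp p f" for c and f :: "'a ae01"
    using that by transfer (auto simp: Bochner_p_integrable_def powr_mult
        intro: strongly_measurable_scaleR)
  show ?thesis
  proof
    show "subspace (Lp p :: 'a ae01 set)"
      by (auto simp: subspace_def Lp_def zero add scale)
    fix x y :: "'a ae01" and c :: real
    assume x: "x \<in> Lp p"
    then have x': "in_Lp p x" by (simp add: Lp_def)
    show "0 \<le> Lp_norm p x"
      by transfer simp
    show "Lp_norm p x = 0 \<longleftrightarrow> x = 0"
      using x'
    proof transfer
      fix p and f :: "real \<Rightarrow> 'a"
      assume "Bochner_p_integrable (lebesgue_on {0<..<1}) p f"
      then have i: "integrable (lebesgue_on {0<..<1}) (\<lambda>x. norm (f x) powr p)"
        by (simp add: Bochner_p_integrable_def)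
      show "((\<integral>x. norm (f x) powr p \<partial>lebesgue_on {0<..<1}) powr (1 / p) = 0) =
          (AE x in lebesgue_on {0<..<1}. f x = 0)"
        using integral_nonneg_eq_0_iff_AE[OF i] by simp
    qed
    show "Lp_norm p (c *\<^sub>R x) = \<bar>c\<bar> * Lp_norm p x"
      using p by transfer (simp add: powr_mult powr_powr integral_nonneg_AE)
    assume "y \<in> Lp p"
    then have "in_Lp p y" by (simp add: Lp_def)
    with p x' show "Lp_norm p (x + y) \<le> Lp_norm p x + Lp_norm p y"
      by transfer (rule Bochner_p_Minkowski(2))
  qed
qed


section \<open>The Bochner transform and its left inverse\<close>

lemma AE_lebesgue_shift:
  assumes "AE x in lebesgue. P x"
  shows "AE x in lebesgue. P (c + x :: real)"
proof -
  have "AE x in lborel. P x"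
    using assms by (simp add: AE_completion_iff)
  then have "AE x in lborel. P (c + x)"
    by (subst (asm) lborel_distr_plus[of c, symmetric]) (rule AE_distrD, simp_all)
  then show ?thesis
    by (rule AE_completion)
qed

lift_definition bochner_transform :: "'a::real_normed_vector aeR \<Rightarrow> real \<Rightarrow> 'a ae01"
  is "\<lambda>u t \<theta>. u (t + \<theta>)"
proof -
  fix u v :: "real \<Rightarrow> 'a" and t
  assume "AE x in lebesgue. u x = v x"
  from AE_lebesgue_shift[OF this, of t]
  show "AE \<theta> in lebesgue_on {0<..<1}. u (t + \<theta>) = v (t + \<theta>)"
    by (auto simp: AE_restrict_space_iff elim: eventually_mono)
qed

text \<open>This is \<open>U([t])({t})\<close>. The second argument lies in \<open>(0,1)\<close> unless \<open>t\<close> is an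
  integer, so the class of the result does not depend on the representatives.\<close>

lift_definition bochner_left_inverse :: "(real \<Rightarrow> 'a::real_normed_vector ae01) \<Rightarrow> 'a aeR"
  is "\<lambda>U t. U (of_int \<lfloor>t\<rfloor>) (frac t)"
proof -
  fix U V :: "real \<Rightarrow> real \<Rightarrow> 'a"
  assume UV: "\<And>t. AE x in lebesgue_on {0<..<1}. U t x = V t x"
  have "AE t in lebesgue. t - of_int n \<in> {0<..<1} \<longrightarrow>
      U (of_int n) (t - of_int n) = V (of_int n) (t - of_int n)" for n :: int
    using AE_lebesgue_shift[where c="- of_int n",
        of "\<lambda>x. x \<in> {0<..<1} \<longrightarrow> U (of_int n) x = V (of_int n) x"] UV[of "of_int n"]
    by (simp add: AE_restrict_space_iff)
  then have "AE t in lebesgue. \<forall>n :: int. t - of_int n \<in> {0<..<1} \<longrightarrow>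
      U (of_int n) (t - of_int n) = V (of_int n) (t - of_int n)"
    by (simp add: AE_all_countable)
  moreover have "AE t :: real in lebesgue. t \<notin> \<int>"
  proof -
    have "AE t :: real in lborel. t \<notin> \<int>"
      by (intro AE_not_in countable_imp_null_set_lborel countable_int)
    then show ?thesis by (rule AE_completion)
  qed
  ultimately show "AE t in lebesgue.
      U (of_int \<lfloor>t\<rfloor>) (frac t) = V (of_int \<lfloor>t\<rfloor>) (frac t)"
  proof eventually_elim
    case (elim t)
    have "frac t \<in> {0<..<1}"
      using elim(2) frac_lt_1[of t] frac_gt_0_iff[of t] by simp
    then show ?case
      using elim(1)[rule_format, of "\<lfloor>t\<rfloor>"] by (simp add: frac_def)
  qed
qed


section \<open>Stepanov spaces\<close>

definition BSp :: "real \<Rightarrow> 'a::real_normed_vector aeR set" where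
  "BSp p = {u. in_Lp_loc p u \<and> bochner_transform u \<in> BC (Lp p) (Lp_norm p)}"

definition Sp_aa :: "real \<Rightarrow> 'a::real_normed_vector aeR set" where
  "Sp_aa p = {u. in_Lp_loc p u \<and> bochner_transform u \<in> AA (Lp p) (Lp_norm p)}"

definition Sp_ap :: "real \<Rightarrow> 'a::real_normed_vector aeR set" where
  "Sp_ap p = {u. in_Lp_loc p u \<and> bochner_transform u \<in> AP (Lp p) (Lp_norm p)}"

lift_definition Sp_norm :: "real \<Rightarrow> 'a::real_normed_vector aeR \<Rightarrow> real"
  is "\<lambda>p u. SUP t. (\<integral>\<theta>. norm (u (t + \<theta>)) powr p \<partial>lebesgue_on {0<..<1}) powr (1 / p)"
proof -
  fix p and f g :: "real \<Rightarrow> 'a"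
  assume fg: "AE x in lebesgue. f x = g x"
  have "AE \<theta> in lebesgue_on {0<..<1}. norm (f (t + \<theta>)) powr p = norm (g (t + \<theta>)) powr p" for t
    using AE_lebesgue_shift[OF fg, of t] by (auto simp: AE_restrict_space_iff elim: eventually_mono)
  then show "(SUP t. (\<integral>\<theta>. norm (f (t + \<theta>)) powr p \<partial>lebesgue_on {0<..<1}) powr (1 / p)) =
      (SUP t. (\<integral>\<theta>. norm (g (t + \<theta>)) powr p \<partial>lebesgue_on {0<..<1}) powr (1 / p))"
    by (intro SUP_cong refl arg_cong[where f="\<lambda>I. I powr _"]
        complete_measure.integral_AE_cong_complete(2)[OF complete_measure_lebesgue_on]) auto
qed

end

theory Submission
  imports Defs
begin

text \<open>The composition \<open>P = B \<circ> L\<close> is a bounded projection with image \<open>Im(B)\<close> and kernel \<open>M\<close>,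
  because \<open>L \<circ> B = I\<close> and \<open>LU\<close> depends only on the values of \<open>U\<close> at the integers, each
  of which is recovered from \<open>LU\<close>. So everything reduces to \<open>P\<close> preserving the three classes of
  functions. On every bounded interval \<open>LU\<close> is a finite sum of translates of functions in
  \<open>L\<^sup>p(\<real>)\<close>, so continuity
  of \<open>PU\<close> is the continuity of translations in \<open>L\<^sup>p\<close>, and boundedness follows from
  \<open>\<parallel>PU(t)\<parallel> \<le> \<parallel>U([t])\<parallel> + \<parallel>U([t] + 1)\<parallel>\<close>. Almost periodicity and almost automorphy are
  inherited because \<open>P\<close> commutes with integer translations: an almost periodic function has
  relatively dense integer almost periods, and the fractional parts of a sequence of translations
  converge along a subsequence.\<close>

section \<open>Normed carriers and projections\<close>

text \<open>The obstacle is a mismatch of translations: almost periodicity and almost automorphy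
  concern all real translations, while the projection respects only the grid of integers. For almost
  periods it is overcome by compactness: the line splits into finitely many cells such that two
  numbers in one cell differ by an almost period, and this can be exploited inside any relatively
  dense group, in particular inside the integers. The same device, with two partitions superposed,
  gives common almost periods of two functions and hence closure under sums. For almost automorphy
  the difficulty is that the limit function \<open>V\<close> need not be continuous. The estimates
  for \<open>P\<close> that it meets are therefore phrased through integer values alone; continuity
  of \<open>PV\<close> costs nothing, since it is the Bochner transform of a locally p-integrable
  function. Inclusion of both classes in BC has to be proved as well, because
  \<open>sup_norm\<close> is controlled only for bounded functions.\<close>

context normed_carrier
begin

lemmas zero_mem = subspace_0[OF subspace]
  and add_mem = subspace_add[OF subspace]
  and diff_mem = subspace_diff[OF subspace]
  and scale_mem = subspace_scale[OF subspace]

lemma norm_diff_commute: "x \<in> E \<Longrightarrow> y \<in> E \<Longrightarrow> N (x - y) = N (y - x)"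
  using norm_scale[of "x - y" "-1"] by (simp add: diff_mem)

lemma norm_diff_triangle:
  assumes "x \<in> E" "y \<in> E" "z \<in> E"
  shows "N (x - z) \<le> N (x - y) + N (y - z)"
  using norm_triangle[of "x - y" "y - z"] assms by (simp add: diff_mem)

lemma norm_le_diff_add: "x \<in> E \<Longrightarrow> y \<in> E \<Longrightarrow> N x \<le> N (x - y) + N y"
  using norm_triangle[of "x - y" y] by (simp add: diff_mem)

lemma norm_add_diff_add_le:
  assumes "x \<in> E" "y \<in> E" "x' \<in> E" "y' \<in> E"
  shows "N ((x + y) - (x' + y')) \<le> N (x - x') + N (y - y')"
  using norm_triangle[of "x - x'" "y - y'"] assms by (simp add: diff_mem algebra_simps)

lemma norm_scale_diff_scale: "x \<in> E \<Longrightarrow> y \<in> E \<Longrightarrow> N (c *\<^sub>R x - c *\<^sub>R y) = \<bar>c\<bar> * N (x - y)"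
  using norm_scale[of "x - y" c] by (simp add: diff_mem scaleR_diff_right)

lemma normed_carrier_subset: "real_vector.subspace S \<Longrightarrow> S \<subseteq> E \<Longrightarrow> normed_carrier S N"
  using norm_nonneg norm_eq_0 norm_triangle norm_scale by unfold_locales blast+

text \<open>Convergence in the metric topology includes eventual membership in \<open>E\<close>,
  about which the values of \<open>N\<close> say nothing; the range hypothesis supplies it.\<close>

lemma limitin_norm_metric:
  assumes "range f \<subseteq> E"
  shows "limitin (mtopology_of (norm_metric E N)) f l F \<longleftrightarrow> l \<in> E \<and> ((\<lambda>k. N (f k - l)) \<longlongrightarrow> 0) F"
proof -
  interpret M: Metric_space E "norm_dist E N"
    by (rule Metric_space_norm_dist)
  have mem: "f k \<in> E" for k
    using assms by blast
  have "limitin (mtopology_of (norm_metric E N)) f l F \<longleftrightarrow> limitin M.mtopology f l F"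
    by (simp add: mtopology_of_def)
  also have "\<dots> \<longleftrightarrow> l \<in> E \<and> ((\<lambda>k. N (f k - l)) \<longlongrightarrow> 0) F"
    using mem by (auto simp: M.limitin_metric tendsto_iff norm_dist_def diff_mem norm_nonneg)
  finally show ?thesis .
qed

text \<open>With \<open>nhds t\<close> in place of \<open>at t\<close>, composition with any
  \<open>s\<close> tending to \<open>t\<close> is allowed, even if \<open>s\<close> takes the value
  \<open>t\<close>.\<close>

lemma continuous_map_norm_metric:
  "continuous_map euclideanreal (mtopology_of (norm_metric E N)) u \<longleftrightarrow>
     range u \<subseteq> E \<and> (\<forall>t. ((\<lambda>s. N (u s - u t)) \<longlongrightarrow> 0) (nhds t))"
proof -
  interpret M: Metric_space E "norm_dist E N"
    by (rule Metric_space_norm_dist)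
  have mtop: "mtopology_of (norm_metric E N) = M.mtopology"
    by (simp add: mtopology_of_def)
  have range: "range u \<subseteq> E" if "continuous_map euclideanreal (mtopology_of (norm_metric E N)) u"
    using continuous_map_image_subset_topspace[OF that] by (simp add: mtop)
  have "continuous_map euclideanreal M.mtopology u \<longleftrightarrow>
      (\<forall>t. ((\<lambda>s. N (u s - u t)) \<longlongrightarrow> 0) (nhds t))" if "range u \<subseteq> E"
  proof -
    have mem: "u s \<in> E" for s using that by blast
    have [simp]: "norm_dist E N (u t) (u s) = N (u s - u t)" for s t
      using mem by (simp add: norm_dist_def norm_diff_commute)
    show ?thesis
      using mem Met_TC.metric_continuous_map[OF Metric_space_norm_dist, of u]
      by (auto simp: image_subset_iff tendsto_iff eventually_nhds_metric dist_commute
          norm_nonneg diff_mem)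
  qed
  then show ?thesis
    using range mtop by auto
qed

lemma continuous_map_norm_metric_tendsto:
  assumes "continuous_map euclideanreal (mtopology_of (norm_metric E N)) u" "(s \<longlongrightarrow> t) F"
  shows "((\<lambda>k. N (u (s k) - u t)) \<longlongrightarrow> 0) F"
  using assms by (auto simp: continuous_map_norm_metric intro: filterlim_compose)

lemma continuous_map_norm_metric_add:
  assumes "continuous_map euclideanreal (mtopology_of (norm_metric E N)) u"
    and "continuous_map euclideanreal (mtopology_of (norm_metric E N)) v"
  shows "continuous_map euclideanreal (mtopology_of (norm_metric E N)) (u + v)"
proof -
  have mem: "u t \<in> E" "v t \<in> E" for t
    using assms by (auto simp: continuous_map_norm_metric)
  have "((\<lambda>s. N ((u + v) s - (u + v) t)) \<longlongrightarrow> 0) (nhds t)" for t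
  proof (rule tendsto_0_le[where K=1])
    show "((\<lambda>s. N (u s - u t) + N (v s - v t)) \<longlongrightarrow> 0) (nhds t)"
      using assms by (auto simp: continuous_map_norm_metric intro: tendsto_add_zero)
    show "\<forall>\<^sub>F s in nhds t. norm (N ((u + v) s - (u + v) t)) \<le>
        norm (N (u s - u t) + N (v s - v t)) * 1"
    proof (intro always_eventually allI)
      fix s
      show "norm (N ((u + v) s - (u + v) t)) \<le> norm (N (u s - u t) + N (v s - v t)) * 1"
        using norm_add_diff_add_le[OF mem(1)[of s] mem(2)[of s] mem(1)[of t] mem(2)[of t]]
        by (simp add: norm_nonneg diff_mem add_mem mem)
    qed
  qed
  then show ?thesis
    using mem by (auto simp: continuous_map_norm_metric add_mem)
qed

lemma continuous_map_norm_metric_scale: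
  assumes "continuous_map euclideanreal (mtopology_of (norm_metric E N)) u"
  shows "continuous_map euclideanreal (mtopology_of (norm_metric E N)) (c *\<^sub>R u)"
proof -
  have mem: "u t \<in> E" for t
    using assms by (auto simp: continuous_map_norm_metric)
  show ?thesis
    using assms by (auto simp: continuous_map_norm_metric scale_mem norm_scale_diff_scale mem
        intro!: tendsto_mult_right_zero)
qed

text \<open>For \<open>\<sigma> k\<close> in the kernel, \<open>T l = T (l - \<sigma> k)\<close>, so
  \<open>NF (T l)\<close> is bounded by a multiple of \<open>N (\<sigma> k - l)\<close>, which tends
  to 0. Sequences suffice in a metric space.\<close>

lemma closed_subspace_kernel:
  assumes F: "normed_carrier F NF" and T: "bounded_operator E N F NF T"
  shows "closed_subspace E N {x \<in> E. T x = 0}"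
proof -
  interpret F: normed_carrier F NF by (rule F)
  interpret M: Metric_space E "norm_dist E N"
    by (rule Metric_space_norm_dist)
  have TF: "T x \<in> F" and T_add: "T (x + y) = T x + T y"
    and T_scale: "T (c *\<^sub>R x) = c *\<^sub>R T x" if "x \<in> E" "y \<in> E" for x y c
    using T that by (auto simp: bounded_operator_def)
  obtain K where K: "\<And>x. x \<in> E \<Longrightarrow> NF (T x) \<le> K * N x"
    using T unfolding bounded_operator_def by blast
  have T0: "T 0 = 0"
    using T_scale[OF zero_mem zero_mem, of 0] by simp
  have T_diff: "T (x - y) = T x - T y" if "x \<in> E" "y \<in> E" for x y
    using T_add[of "x - y" y] that by (simp add: diff_mem)
  have "closedin (mtopology_of (norm_metric E N)) {x \<in> E. T x = 0}"
  proof -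
    have "T l = 0" if \<sigma>: "range \<sigma> \<subseteq> {x \<in> E. T x = 0}" and lim: "limitin M.mtopology \<sigma> l sequentially" for \<sigma> l
    proof -
      have \<sigma>E: "\<sigma> k \<in> E" "T (\<sigma> k) = 0" for k using \<sigma> by auto
      have l: "l \<in> E" and "(\<lambda>k. N (\<sigma> k - l)) \<longlonglongrightarrow> 0"
        using lim limitin_norm_metric[of \<sigma> l sequentially] \<sigma>E(1) by (auto simp: mtopology_of_def)
      then have "(\<lambda>k. K * N (\<sigma> k - l)) \<longlonglongrightarrow> 0"
        by (intro tendsto_mult_right_zero)
      moreover have "NF (T l) \<le> K * N (\<sigma> k - l)" for k
        using K[of "l - \<sigma> k"] T_diff[OF l, of "\<sigma> k"] l \<sigma>E
        by (simp add: diff_mem norm_diff_commute)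
      ultimately have "NF (T l) \<le> 0"
        by (intro tendsto_lowerbound) auto
      then show "T l = 0"
        using F.norm_nonneg[of "T l"] F.norm_eq_0[of "T l"] TF[OF l l] by simp
    qed
    then have "closedin M.mtopology {x \<in> E. T x = 0}"
      by (auto simp: M.metric_closedin_iff_sequentially_closed M.limitin_mspace)
    then show ?thesis by (simp add: mtopology_of_def)
  qed
  then show ?thesis
    by (auto simp: closed_subspace_def subspace_def T0 T_add T_scale zero_mem add_mem scale_mem)
qed

text \<open>Both summands are kernels of bounded operators on \<open>E\<close>: the image of
  \<open>B\<close> is the kernel of \<open>I - P\<close>, and the kernel of \<open>L\<close> is that
  of \<open>P\<close>. Closedness is then the previous lemma used twice, and
  \<open>x = P x + (x - P x)\<close> is the decomposition.\<close>

lemma left_inverse_decomposition: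
  assumes BL: "left_inverse X NX E N B L" and NX: "\<And>x. x \<in> X \<Longrightarrow> 0 \<le> NX x"
  shows "closed_subspace E N (B ` X)" "closed_subspace E N {x \<in> E. L x = 0}"
    "direct_sum E (B ` X) {x \<in> E. L x = 0}"
proof -
  define P where "P x = B (L x)" for x
  have L: "L x \<in> X" "L (c *\<^sub>R x) = c *\<^sub>R L x" if "x \<in> E" for x c
    using BL that by (auto simp: left_inverse_def bounded_operator_def)
  have L_add: "L (x + y) = L x + L y" if "x \<in> E" "y \<in> E" for x y
    using BL that by (auto simp: left_inverse_def bounded_operator_def)
  have B: "B x \<in> E" "B (c *\<^sub>R x) = c *\<^sub>R B x" if "x \<in> X" for x c
    using BL that by (auto simp: left_inverse_def bounded_operator_def)
  have B_add: "B (x + y) = B x + B y" if "x \<in> X" "y \<in> X" for x y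
    using BL that by (auto simp: left_inverse_def bounded_operator_def)
  have LB: "L (B x) = x" if "x \<in> X" for x
    using BL that by (auto simp: left_inverse_def)
  have P: "P x \<in> E" "P (c *\<^sub>R x) = c *\<^sub>R P x" "P (P x) = P x" if "x \<in> E" for x c
    using that by (simp_all add: P_def L B LB)
  have P_add: "P (x + y) = P x + P y" if "x \<in> E" "y \<in> E" for x y
    using that by (simp add: P_def L L_add B_add)
  have L0: "L 0 = 0" and B0: "B 0 = 0"
    using L(2)[OF zero_mem, of 0] B(2)[OF L(1)[OF zero_mem], of 0]
    by simp_all
  obtain K where K: "0 \<le> K" "\<And>x. x \<in> E \<Longrightarrow> N (P x) \<le> K * N x"
  proof -
    have "\<exists>K1. \<forall>x\<in>X. N (B x) \<le> K1 * NX x" and "\<exists>K2. \<forall>x\<in>E. NX (L x) \<le> K2 * N x"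
      using BL by (simp_all add: left_inverse_def bounded_operator_def)
    then obtain K1 K2 where K1: "\<And>x. x \<in> X \<Longrightarrow> N (B x) \<le> K1 * NX x"
      and K2: "\<And>x. x \<in> E \<Longrightarrow> NX (L x) \<le> K2 * N x"
      by blast
    \<comment> \<open>The constants of a \<open>bounded_operator\<close> may be negative; absolute
      values allow the two bounds to be multiplied.\<close>
    have "N (P x) \<le> \<bar>K1\<bar> * (\<bar>K2\<bar> * N x)" if x: "x \<in> E" for x
    proof -
      have "N (P x) \<le> \<bar>K1\<bar> * NX (L x)"
        using K1[OF L(1)[OF x]] mult_right_mono[OF abs_ge_self[of K1] NX[OF L(1)[OF x]]]
        by (simp add: P_def)
      moreover have "NX (L x) \<le> \<bar>K2\<bar> * N x"
        using K2[OF x] mult_right_mono[OF abs_ge_self[of K2] norm_nonneg[OF x]] by linarith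
      ultimately show ?thesis
        using mult_left_mono[of "NX (L x)" "\<bar>K2\<bar> * N x" "\<bar>K1\<bar>"] by linarith
    qed
    then show thesis by (intro that[of "\<bar>K1\<bar> * \<bar>K2\<bar>"]) (auto simp: mult.assoc)
  qed
  have bP: "bounded_operator E N E N P"
    using P P_add K(2) by (auto simp: bounded_operator_def intro!: exI[of _ K])
  have "bounded_operator E N E N (\<lambda>x. x - P x)"
  proof -
    have "N (x - P x) \<le> (1 + K) * N x" if x: "x \<in> E" for x
      using norm_triangle[of x "- P x"] norm_scale[of "P x" "-1"] K(2)[OF x] x P(1)[OF x]
        scale_mem[of "P x" "-1"]
      by (simp add: distrib_right)
    then show ?thesis
      using P P_add by (auto simp: bounded_operator_def diff_mem algebra_simps intro!: exI[of _ "1 + K"])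
  qed
  then have "closed_subspace E N {x \<in> E. x - P x = 0}"
    by (rule closed_subspace_kernel[OF normed_carrier_axioms])
  moreover have "{x \<in> E. x - P x = 0} = B ` X"
    using B LB by (auto simp: P_def L image_iff)
  ultimately show "closed_subspace E N (B ` X)" by simp
  \<comment> \<open>\<open>P x = 0\<close> gives \<open>L x = L (P x) = L 0 = 0\<close>.\<close>
  have ker: "{x \<in> E. P x = 0} = {x \<in> E. L x = 0}"
    using LB[OF L(1)] L0 B0 by (auto simp: P_def) metis
  show "closed_subspace E N {x \<in> E. L x = 0}"
    using closed_subspace_kernel[OF normed_carrier_axioms bP] by (simp add: ker)
  show "direct_sum E (B ` X) {x \<in> E. L x = 0}"
    unfolding direct_sum_def
  proof
    show "E = {x + y |x y. x \<in> B ` X \<and> y \<in> {x \<in> E. L x = 0}}"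
    proof safe
      fix x assume x: "x \<in> E"
      have "P (x - P x) = 0"
        using P_add[of "x - P x" "P x"] P(1,3)[OF x] x by (simp add: diff_mem)
      then have "x - P x \<in> {x \<in> E. L x = 0}"
        unfolding ker[symmetric] using x P(1)[OF x] by (simp add: diff_mem)
      then show "\<exists>xa y. x = xa + y \<and> xa \<in> B ` X \<and> y \<in> {x \<in> E. L x = 0}"
        using imageI[OF L(1)[OF x], of B] unfolding P_def
        by (intro exI[of _ "B (L x)"] exI[of _ "x - B (L x)"]) simp
    qed (auto simp: B add_mem)
    show "B ` X \<inter> {x \<in> E. L x = 0} = {0}"
      using LB B0 L0 zero_mem L(1)[OF zero_mem] by (auto intro!: image_eqI[of 0 B 0])
  qed
qed

end

section \<open>Almost periodic functions\<close>

lemma relatively_dense_mono: "relatively_dense P \<Longrightarrow> P \<subseteq> Q \<Longrightarrow> relatively_dense Q"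
  unfolding relatively_dense_def by blast

lemma relatively_dense_Ints: "relatively_dense \<int>"
proof -
  have "of_int \<lceil>a\<rceil> \<in> \<int> \<inter> {a..a + 1}" for a :: real
    using ceiling_correct[of a] by auto
  then show ?thesis
    unfolding relatively_dense_def by (intro exI[of _ 1] conjI allI) (simp, blast)
qed

lemma relatively_dense_UNIV: "relatively_dense UNIV"
  using relatively_dense_mono[OF relatively_dense_Ints] by simp

text \<open>A set of differences within the finitely many cells \<open>\<phi> -` {c}\<close> is relatively dense, since
  each cell has a representative and the representatives form a bounded set.\<close>

lemma relatively_dense_differences:
  fixes \<phi> :: "real \<Rightarrow> 'c"
  assumes "finite (range \<phi>)" "relatively_dense S"
    and P: "\<And>s s'. s \<in> S \<Longrightarrow> s' \<in> S \<Longrightarrow> \<phi> s = \<phi> s' \<Longrightarrow> s - s' \<in> P"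
  shows "relatively_dense P"
proof -
  obtain l where l: "0 < l" "\<And>a. S \<inter> {a..a + l} \<noteq> {}"
    using assms(2) unfolding relatively_dense_def by blast
  define R where "R = inv_into S \<phi> ` \<phi> ` S"
  have "finite R"
    using finite_subset[OF image_mono[OF subset_UNIV] assms(1), of S] by (simp add: R_def)
  then obtain M where M: "\<And>s. s \<in> R \<Longrightarrow> \<bar>s\<bar> \<le> M"
    using bounded_real[of R] finite_imp_bounded by blast
  have R: "\<exists>s'\<in>R. s' \<in> S \<and> \<phi> s' = \<phi> s" if "s \<in> S" for s
    using that by (auto simp: R_def inv_into_into f_inv_into_f
        intro!: bexI[of _ "inv_into S \<phi> (\<phi> s)"])
  have "P \<inter> {a..a + (l + 2 * M)} \<noteq> {}" for a
  proof -
    \<comment> \<open>The window is moved right by \<open>M\<close>, so that subtracting a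
      representative of modulus at most \<open>M\<close> cannot leave
      \<open>{a..a + (l + 2 * M)}\<close> on either side.\<close>
    obtain s where s: "s \<in> S" "a + M \<le> s" "s \<le> a + M + l"
      using l(2)[of "a + M"] by auto
    obtain s' where s': "s' \<in> R" "s' \<in> S" "\<phi> s' = \<phi> s"
      using R[OF s(1)] by blast
    have "s - s' \<in> P"
      using P[OF s(1) s'(2)] s'(3) by simp
    moreover have "s - s' \<in> {a..a + (l + 2 * M)}"
      using s M[OF s'(1)] by (auto simp: abs_le_iff)
    ultimately show ?thesis by blast
  qed
  moreover have "0 < l + 2 * M"
  proof -
    obtain s where "s \<in> S" using l(2)[of 0] by auto
    then obtain s' where "s' \<in> R" using R by blast
    then show ?thesis using M[of s'] l(1) by linarith
  qed
  ultimately show ?thesis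
    unfolding relatively_dense_def by blast
qed

context normed_carrier
begin

text \<open>\<open>u\<close> takes values in a carrier, so compactness is applied to the real
  function \<open>g (s, t) = N (u s - u t)\<close> on the square. It vanishes on the diagonal, and
  \<open>(s, t)\<close> is compared with \<open>(t, t)\<close>.\<close>

lemma uniformly_continuous_on_interval:
  assumes cont: "continuous_map euclideanreal (mtopology_of (norm_metric E N)) u" and "0 < e"
  shows "\<exists>d>0. \<forall>s\<in>{a..b}. \<forall>t\<in>{a..b}. \<bar>s - t\<bar> < d \<longrightarrow> N (u s - u t) < e"
proof -
  have mem: "u s \<in> E" for s
    using cont by (auto simp: continuous_map_norm_metric)
  define g where "g z = N (u (fst z) - u (snd z))" for z
  have "isCont g z" for z
  proof -
    obtain s t where z: "z = (s, t)" by fastforce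
    have bound: "norm (g w - g z) \<le> N (u (fst w) - u s) + N (u (snd w) - u t)" for w
    proof -
      obtain s' t' where w: "w = (s', t')" by fastforce
      have "N (u s' - u t') \<le> N (u s' - u s) + N (u s - u t) + N (u t' - u t)"
        using norm_diff_triangle[OF mem mem mem, of s' t' s] norm_diff_triangle[OF mem mem mem, of s t' t]
          norm_diff_commute[OF mem mem, of t' t] by linarith
      moreover have "N (u s - u t) \<le> N (u s' - u s) + N (u s' - u t') + N (u t' - u t)"
        using norm_diff_triangle[OF mem mem mem, of s t s'] norm_diff_triangle[OF mem mem mem, of s' t t']
          norm_diff_commute[OF mem mem, of s s'] by linarith
      ultimately show ?thesis by (simp add: g_def w z)
    qed
    have "((\<lambda>w. N (u (fst w) - u s) + N (u (snd w) - u t)) \<longlongrightarrow> 0) (at z)"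
      by (intro tendsto_add_zero continuous_map_norm_metric_tendsto[OF cont]) (auto simp: z intro!: tendsto_eq_intros)
    then have "((\<lambda>w. g w - g z) \<longlongrightarrow> 0) (at z)"
      by (rule Lim_null_comparison[OF always_eventually, rotated]) (intro allI bound)
    then show ?thesis
      by (simp add: isCont_def LIM_zero_iff)
  qed
  then have "continuous_on ({a..b} \<times> {a..b}) g"
    by (intro continuous_at_imp_continuous_on) auto
  then have "uniformly_continuous_on ({a..b} \<times> {a..b}) g"
    by (intro compact_uniformly_continuous compact_Times) auto
  then obtain d where d: "0 < d"
    "\<And>z w. z \<in> {a..b} \<times> {a..b} \<Longrightarrow> w \<in> {a..b} \<times> {a..b} \<Longrightarrow> dist w z < d \<Longrightarrow> dist (g w) (g z) < e"
    using \<open>0 < e\<close> unfolding uniformly_continuous_on_def by blast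
  have "N (u s - u t) < e" if "s \<in> {a..b}" "t \<in> {a..b}" "\<bar>s - t\<bar> < d" for s t
  proof -
    have "dist (g (s, t)) (g (t, t)) < e"
      using that by (intro d(2)) (auto simp: dist_Pair_Pair dist_real_def)
    then show ?thesis
      using norm_eq_0[OF zero_mem] by (simp add: g_def dist_real_def)
  qed
  then show ?thesis using d(1) by blast
qed

lemma AP_iff:
  "u \<in> AP E N \<longleftrightarrow> continuous_map euclideanreal (mtopology_of (norm_metric E N)) u \<and>
     (\<forall>\<epsilon>>0. relatively_dense {\<tau>. \<forall>t. N (u (t + \<tau>) - u t) \<le> \<epsilon>})"
  by (simp add: AP_def)

text \<open>Bochner's criterion: the translates of an almost periodic function are totally bounded, so
  they fall into finitely many classes of small diameter.\<close>

lemma AP_translates_totally_bounded: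
  assumes u: "u \<in> AP E N" and "0 < e"
  obtains \<phi> :: "real \<Rightarrow> int"
  where "finite (range \<phi>)" "\<And>s s' t. \<phi> s = \<phi> s' \<Longrightarrow> N (u (t + s) - u (t + s')) \<le> e"
proof -
  have cont: "continuous_map euclideanreal (mtopology_of (norm_metric E N)) u"
    and rel: "\<And>\<epsilon>. 0 < \<epsilon> \<Longrightarrow> relatively_dense {\<tau>. \<forall>t. N (u (t + \<tau>) - u t) \<le> \<epsilon>}"
    using u by (auto simp: AP_iff)
  have mem: "u s \<in> E" for s
    using cont by (auto simp: continuous_map_norm_metric)
  \<comment> \<open>The final estimate spends \<open>2 * \<epsilon>\<close> in \<open>shift\<close>
    and \<open>3 * \<epsilon>\<close> in \<open>unif\<close>.\<close>
  define \<epsilon> where "\<epsilon> = e / 5"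
  have \<epsilon>: "0 < \<epsilon>" using \<open>0 < e\<close> by (simp add: \<epsilon>_def)
  obtain l where l: "0 < l" "\<And>a. {\<tau>. \<forall>t. N (u (t + \<tau>) - u t) \<le> \<epsilon>} \<inter> {a..a + l} \<noteq> {}"
    using rel[OF \<epsilon>] unfolding relatively_dense_def by blast
  have "\<exists>\<tau>. (\<forall>t. N (u (t + \<tau>) - u t) \<le> \<epsilon>) \<and> - s \<le> \<tau> \<and> \<tau> \<le> - s + l" for s
    using l(2)[of "- s"] by auto
  \<comment> \<open>The almost period \<open>\<tau> s\<close> carries \<open>s\<close> into the
    compact interval \<open>{0..l}\<close>.\<close>
  then obtain \<tau> where \<tau>: "\<And>s t. N (u (t + \<tau> s) - u t) \<le> \<epsilon>" "\<And>s. - s \<le> \<tau> s" "\<And>s. \<tau> s \<le> - s + l"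
    by metis
  have shift: "N (u x - u y) \<le> 2 * \<epsilon> + N (u (x + \<tau> s) - u (y + \<tau> s'))" for x y s s'
    using norm_diff_triangle[OF mem mem mem, of x y "x + \<tau> s"]
      norm_diff_triangle[OF mem mem mem, of "x + \<tau> s" y "y + \<tau> s'"]
      norm_diff_commute[OF mem mem, of x "x + \<tau> s"] \<tau>(1)[of x s] \<tau>(1)[of y s'] by linarith
  \<comment> \<open>\<open>x + \<tau> x\<close> lies in \<open>{0..l}\<close>, and
    \<open>y + \<tau> x\<close> is less than 1 away from it; hence the margin of 1 at both ends and
    the cap \<open>d' \<le> 1\<close>.\<close>
  obtain d where d: "0 < d" "\<And>s t. s \<in> {-1..l+1} \<Longrightarrow> t \<in> {-1..l+1} \<Longrightarrow> \<bar>s - t\<bar> < d \<Longrightarrow> N (u s - u t) < \<epsilon>"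
    using uniformly_continuous_on_interval[OF cont \<epsilon>, of "-1" "l+1"] by blast
  define d' where "d' = min d 1"
  have d': "0 < d'" "d' \<le> d" "d' \<le> 1" using d(1) by (auto simp: d'_def)
  have unif: "N (u x - u y) \<le> 3 * \<epsilon>" if "\<bar>x - y\<bar> < d'" for x y
    using shift[of x y x x] d(2)[of "x + \<tau> x" "y + \<tau> x"] \<tau>(2,3)[of x] that d' by (simp add: abs_less_iff)
  \<comment> \<open>The number of the cell of length \<open>d'\<close> that contains
    \<open>s + \<tau> s\<close>; only finitely many cells meet \<open>{0..l}\<close>.\<close>
  define \<phi> where "\<phi> s = \<lfloor>(s + \<tau> s) / d'\<rfloor>" for s
  show thesis
  proof
    have "range \<phi> \<subseteq> {0..\<lfloor>l / d'\<rfloor>}"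
    proof (rule image_subsetI)
      fix s
      have "0 \<le> (s + \<tau> s) / d'" "(s + \<tau> s) / d' \<le> l / d'"
        using \<tau>(2,3)[of s] d'(1) by (simp_all add: divide_right_mono)
      then show "\<phi> s \<in> {0..\<lfloor>l / d'\<rfloor>}"
        by (simp add: \<phi>_def floor_mono)
    qed
    then show "finite (range \<phi>)"
      by (rule finite_subset) simp
  next
    fix s s' t assume "\<phi> s = \<phi> s'"
    then have "\<bar>(s + \<tau> s) / d' - (s' + \<tau> s') / d'\<bar> < 1"
      unfolding \<phi>_def by linarith
    then have "\<bar>(s + \<tau> s) - (s' + \<tau> s')\<bar> < d'"
      using d'(1) by (simp add: diff_divide_distrib[symmetric] abs_divide)
    then have "N (u (t + s + \<tau> s) - u (t + s' + \<tau> s')) \<le> 3 * \<epsilon>"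
      by (intro unif) (simp add: algebra_simps)
    then show "N (u (t + s) - u (t + s')) \<le> e"
      using shift[of "t + s" "t + s'" s s'] by (simp add: \<epsilon>_def)
  qed
qed

text \<open>Evaluating the cell estimate at \<open>t - s'\<close> makes \<open>s - s'\<close> an
  almost period whenever \<open>s\<close> and \<open>s'\<close> share a cell. The set
  \<open>S\<close> is kept general: the integers give integer almost periods, and the whole line
  with a product of two partitions gives common ones.\<close>

lemma relatively_dense_almost_periods:
  assumes "finite (range \<phi>)" "\<And>s s' t. \<phi> s = \<phi> s' \<Longrightarrow> N (u (t + s) - u (t + s')) \<le> e"
    and "relatively_dense S" "\<And>s s'. s \<in> S \<Longrightarrow> s' \<in> S \<Longrightarrow> s - s' \<in> S"
  shows "relatively_dense {\<tau> \<in> S. \<forall>t. N (u (t + \<tau>) - u t) \<le> e}"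
proof (rule relatively_dense_differences[OF assms(1,3)])
  fix s s' assume s: "s \<in> S" "s' \<in> S" "\<phi> s = \<phi> s'"
  have "N (u (t + (s - s')) - u t) \<le> e" for t
    using assms(2)[OF s(3), of "t - s'"] by (simp add: algebra_simps)
  then show "s - s' \<in> {\<tau> \<in> S. \<forall>t. N (u (t + \<tau>) - u t) \<le> e}"
    using assms(4) s by auto
qed

lemma AP_Ints_almost_periods:
  assumes "u \<in> AP E N" "0 < e"
  shows "relatively_dense {\<tau> \<in> \<int>. \<forall>t. N (u (t + \<tau>) - u t) \<le> e}"
proof -
  obtain \<phi> :: "real \<Rightarrow> int" where \<phi>: "finite (range \<phi>)"
    "\<And>s s' t. \<phi> s = \<phi> s' \<Longrightarrow> N (u (t + s) - u (t + s')) \<le> e"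
    using AP_translates_totally_bounded[OF assms] by blast
  show ?thesis
    by (rule relatively_dense_almost_periods[of \<phi> u e, OF \<phi> relatively_dense_Ints Ints_diff])
qed

text \<open>At \<open>t = 0\<close> the cells show that each value of \<open>u\<close> is within 1
  of its value at one of finitely many representatives.\<close>

lemma AP_subset_BC: "AP E N \<subseteq> BC E N"
proof
  fix u assume u: "u \<in> AP E N"
  then have cont: "continuous_map euclideanreal (mtopology_of (norm_metric E N)) u"
    by (simp add: AP_iff)
  then have mem: "u s \<in> E" for s
    by (auto simp: continuous_map_norm_metric)
  obtain \<phi> :: "real \<Rightarrow> int" where \<phi>: "finite (range \<phi>)"
    "\<And>s s' t. \<phi> s = \<phi> s' \<Longrightarrow> N (u (t + s) - u (t + s')) \<le> 1"
    using AP_translates_totally_bounded[OF u zero_less_one] by blast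
  define R where "R = inv \<phi> ` range \<phi>"
  obtain M where M: "\<And>s. s \<in> R \<Longrightarrow> N (u s) \<le> M"
    using finite_imp_bounded[of "(\<lambda>s. N (u s)) ` R"] \<phi>(1) by (auto simp: R_def bounded_real abs_le_iff)
  have "N (u s) \<le> 1 + M" for s
  proof -
    have "N (u (0 + s) - u (0 + inv \<phi> (\<phi> s))) \<le> 1"
      by (rule \<phi>(2)) (simp add: f_inv_into_f)
    moreover have "N (u (inv \<phi> (\<phi> s))) \<le> M"
      by (rule M) (simp add: R_def)
    ultimately show ?thesis
      using norm_le_diff_add[OF mem mem, of s "inv \<phi> (\<phi> s)"] by simp
  qed
  then show "u \<in> BC E N"
    using cont mem by (auto simp: BC_iff)
qed

lemma subspace_AP: "real_vector.subspace (AP E N)"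
proof -
  have mem: "u s \<in> E" if "u \<in> AP E N" for u s
    using that by (auto simp: AP_iff continuous_map_norm_metric)
  have 0: "0 \<in> AP E N"
    using relatively_dense_UNIV zero_mem norm_eq_0[OF zero_mem]
    by (auto simp: AP_iff continuous_map_norm_metric)
  have add: "u + v \<in> AP E N" if u: "u \<in> AP E N" and v: "v \<in> AP E N" for u v
  proof -
    have "relatively_dense {\<tau> \<in> UNIV. \<forall>t. N ((u + v) (t + \<tau>) - (u + v) t) \<le> e}" if e: "0 < e" for e
    proof -
      have "0 < e / 2" using e by simp
      obtain \<phi> :: "real \<Rightarrow> int" where \<phi>: "finite (range \<phi>)"
        "\<And>s s' t. \<phi> s = \<phi> s' \<Longrightarrow> N (u (t + s) - u (t + s')) \<le> e / 2"
        using AP_translates_totally_bounded[OF u \<open>0 < e / 2\<close>] by blast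
      obtain \<psi> :: "real \<Rightarrow> int" where \<psi>: "finite (range \<psi>)"
        "\<And>s s' t. \<psi> s = \<psi> s' \<Longrightarrow> N (v (t + s) - v (t + s')) \<le> e / 2"
        using AP_translates_totally_bounded[OF v \<open>0 < e / 2\<close>] by blast
      show ?thesis
      \<comment> \<open>Almost periods of \<open>u\<close> and of \<open>v\<close> found separately
        need not coincide; the common refinement of the two partitions produces joint ones.\<close>
      proof (rule relatively_dense_almost_periods[where \<phi>="\<lambda>s. (\<phi> s, \<psi> s)", OF _ _ relatively_dense_UNIV])
        show "finite (range (\<lambda>s. (\<phi> s, \<psi> s)))"
          by (rule finite_subset[OF _ finite_cartesian_product[OF \<phi>(1) \<psi>(1)]]) auto
        show "N ((u + v) (t + s) - (u + v) (t + s')) \<le> e" if "(\<phi> s, \<psi> s) = (\<phi> s', \<psi> s')" for s s' t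
          using norm_add_diff_add_le[of "u (t + s)" "v (t + s)" "u (t + s')" "v (t + s')"]
            \<phi>(2)[of s s' t] \<psi>(2)[of s s' t] that by (simp add: mem[OF u] mem[OF v])
      qed auto
    qed
    then show ?thesis
      using u v continuous_map_norm_metric_add by (auto simp: AP_iff)
  qed
  have scale: "c *\<^sub>R u \<in> AP E N" if u: "u \<in> AP E N" for c u
  proof -
    have "relatively_dense {\<tau>. \<forall>t. N ((c *\<^sub>R u) (t + \<tau>) - (c *\<^sub>R u) t) \<le> e}" if e: "0 < e" for e
    proof -
      \<comment> \<open>The summand 1 covers \<open>c = 0\<close>.\<close>
      have pos: "0 < e / (\<bar>c\<bar> + 1)" using e by simp
      have "\<bar>c\<bar> * r \<le> e" if "0 \<le> r" "r \<le> e / (\<bar>c\<bar> + 1)" for r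
      proof -
        have "\<bar>c\<bar> * r \<le> (\<bar>c\<bar> + 1) * r" using that(1) by (simp add: mult_right_mono)
        also have "\<dots> \<le> e" using that(2) by (simp add: pos_le_divide_eq mult.commute)
        finally show ?thesis .
      qed
      then have "{\<tau>. \<forall>t. N (u (t + \<tau>) - u t) \<le> e / (\<bar>c\<bar> + 1)} \<subseteq>
          {\<tau>. \<forall>t. N ((c *\<^sub>R u) (t + \<tau>) - (c *\<^sub>R u) t) \<le> e}"
        by (simp add: norm_scale_diff_scale mem[OF u] norm_nonneg diff_mem subset_iff)
      moreover have "relatively_dense {\<tau>. \<forall>t. N (u (t + \<tau>) - u t) \<le> e / (\<bar>c\<bar> + 1)}"
        using u pos by (simp add: AP_iff)
      ultimately show ?thesis
        by (rule relatively_dense_mono[rotated])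
    qed
    then show ?thesis
      using u continuous_map_norm_metric_scale by (auto simp: AP_iff)
  qed
  show ?thesis
    by (simp add: subspace_def 0 add scale)
qed

section \<open>Almost automorphic functions\<close>

text \<open>The first limit in the metric topology already forces the values of \<open>v\<close>
  into the carrier; once limits are written with \<open>N\<close>, this must be stated as
  \<open>range v \<subseteq> E\<close>.\<close>

lemma AA_iff:
  "u \<in> AA E N \<longleftrightarrow> continuous_map euclideanreal (mtopology_of (norm_metric E N)) u \<and>
     (\<forall>s :: nat \<Rightarrow> real. \<exists>r :: nat \<Rightarrow> nat. strict_mono r \<and> (\<exists>v. range v \<subseteq> E \<and>
       (\<forall>t. (\<lambda>k. N (u (t + s (r k)) - v t)) \<longlonglongrightarrow> 0 \<and> (\<lambda>k. N (v (t - s (r k)) - u t)) \<longlonglongrightarrow> 0)))"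
  (is "_ \<longleftrightarrow> ?c \<and> (\<forall>s. \<exists>r. _ \<and> (\<exists>v. ?P s r v))")
proof -
  have "(\<forall>t. limitin (mtopology_of (norm_metric E N)) (\<lambda>k. u (t + s (r k))) (v t) sequentially \<and>
      limitin (mtopology_of (norm_metric E N)) (\<lambda>k. v (t - s (r k))) (u t) sequentially) \<longleftrightarrow> ?P s r v"
    if ?c for v and s :: "nat \<Rightarrow> real" and r :: "nat \<Rightarrow> nat"
  proof -
    have mem: "u t \<in> E" for t
      using that by (auto simp: continuous_map_norm_metric)
    then have u: "limitin (mtopology_of (norm_metric E N)) (\<lambda>k. u (t + s (r k))) (v t) sequentially \<longleftrightarrow>
        v t \<in> E \<and> (\<lambda>k. N (u (t + s (r k)) - v t)) \<longlonglongrightarrow> 0" for t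
      by (intro limitin_norm_metric) auto
    have v: "limitin (mtopology_of (norm_metric E N)) (\<lambda>k. v (t - s (r k))) (u t) sequentially \<longleftrightarrow>
        (\<lambda>k. N (v (t - s (r k)) - u t)) \<longlonglongrightarrow> 0" if "range v \<subseteq> E" for t
      using mem that by (subst limitin_norm_metric) auto
    show ?thesis
    proof (cases "range v \<subseteq> E")
      case True
      then show ?thesis by (auto simp: u v)
    next
      case False
      then show ?thesis by (auto simp: u)
    qed
  qed
  then show ?thesis
    unfolding AA_def by auto
qed

lemma AA_subsequence:
  fixes s :: "nat \<Rightarrow> real"
  assumes "u \<in> AA E N"
  obtains r :: "nat \<Rightarrow> nat" and v where "strict_mono r" "\<And>t. v t \<in> E"
    "\<And>t. (\<lambda>k. N (u (t + s (r k)) - v t)) \<longlonglongrightarrow> 0"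
    "\<And>t. (\<lambda>k. N (v (t - s (r k)) - u t)) \<longlonglongrightarrow> 0"
proof -
  have "\<exists>r :: nat \<Rightarrow> nat. strict_mono r \<and> (\<exists>v. range v \<subseteq> E \<and>
      (\<forall>t. (\<lambda>k. N (u (t + s (r k)) - v t)) \<longlonglongrightarrow> 0 \<and> (\<lambda>k. N (v (t - s (r k)) - u t)) \<longlonglongrightarrow> 0))"
    using assms unfolding AA_iff by (elim conjE allE)
  then show thesis
    using that by (auto simp: image_subset_iff)
qed

text \<open>If \<open>u\<close> were unbounded, some sequence would have
  \<open>N (u (s n)) > n\<close>. Along a subsequence the values converge at \<open>t = 0\<close>,
  which bounds them by \<open>1 + N (v 0)\<close> eventually, while \<open>k \<le> r k\<close> makes
  them exceed \<open>k\<close>.\<close>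

lemma AA_subset_BC: "AA E N \<subseteq> BC E N"
proof
  fix u assume u: "u \<in> AA E N"
  then have cont: "continuous_map euclideanreal (mtopology_of (norm_metric E N)) u"
    by (simp add: AA_iff)
  then have mem: "u s \<in> E" for s
    by (auto simp: continuous_map_norm_metric)
  have "\<exists>K. \<forall>t. N (u t) \<le> K"
  proof (rule ccontr)
    assume "\<not> ?thesis"
    then have "\<exists>t. real n < N (u t)" for n :: nat
      by (meson not_le)
    then obtain s where s: "\<And>n :: nat. real n < N (u (s n))"
      by metis
    obtain r v where r: "strict_mono (r :: nat \<Rightarrow> nat)" and v: "\<And>t. v t \<in> E"
      and lim_u: "\<And>t. (\<lambda>k. N (u (t + s (r k)) - v t)) \<longlonglongrightarrow> 0"
        "\<And>t. (\<lambda>k. N (v (t - s (r k)) - u t)) \<longlonglongrightarrow> 0"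
      using AA_subsequence[OF u, where s=s] by blast
    have "\<forall>\<^sub>F k in sequentially. N (u (s (r k)) - v 0) < 1"
      using order_tendstoD(2)[OF lim_u(1)[of 0], of 1] by simp
    moreover have "\<forall>\<^sub>F k in sequentially. 1 + N (v 0) \<le> real k"
      using filterlim_real_sequentially by (simp add: filterlim_at_top)
    ultimately have "\<forall>\<^sub>F k in sequentially. False"
    proof eventually_elim
      case (elim k)
      have "N (u (s (r k))) \<le> N (u (s (r k)) - v 0) + N (v 0)"
        using v by (intro norm_le_diff_add mem) auto
      then show False
        using elim s[of "r k"] seq_suble[OF r, of k] by linarith
    qed
    then show False by simp
  qed
  then show "u \<in> BC E N"
    using cont mem by (auto simp: BC_iff)
qed

lemma subspace_AA: "real_vector.subspace (AA E N)"
proof -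
  have mem: "u s \<in> E" if "u \<in> AA E N" for u s
    using that by (auto simp: AA_iff continuous_map_norm_metric)
  have 0: "0 \<in> AA E N"
    unfolding AA_iff
  proof (intro conjI allI)
    fix s :: "nat \<Rightarrow> real"
    show "\<exists>r. strict_mono r \<and> (\<exists>v. range v \<subseteq> E \<and> (\<forall>t.
        (\<lambda>k. N ((0 :: real \<Rightarrow> 'e) (t + s (r k)) - v t)) \<longlonglongrightarrow> 0 \<and> (\<lambda>k. N (v (t - s (r k)) - (0 :: real \<Rightarrow> 'e) t)) \<longlonglongrightarrow> 0))"
      using zero_mem norm_eq_0[OF zero_mem]
      by (intro exI[of _ id] exI[of _ "\<lambda>_. 0"]) (auto simp: strict_mono_def)
  qed (use zero_mem norm_eq_0[OF zero_mem] in \<open>auto simp: continuous_map_norm_metric\<close>)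
  have add: "u + v \<in> AA E N" if u: "u \<in> AA E N" and v: "v \<in> AA E N" for u v
  proof -
    have "\<exists>r. strict_mono r \<and> (\<exists>w. range w \<subseteq> E \<and> (\<forall>t.
        (\<lambda>k. N ((u + v) (t + s (r k)) - w t)) \<longlonglongrightarrow> 0 \<and> (\<lambda>k. N (w (t - s (r k)) - (u + v) t)) \<longlonglongrightarrow> 0))"
      for s :: "nat \<Rightarrow> real"
    proof -
      obtain r1 u' where r1: "strict_mono (r1 :: nat \<Rightarrow> nat)" and u': "\<And>t. u' t \<in> E"
        and lim1: "\<And>t. (\<lambda>k. N (u (t + s (r1 k)) - u' t)) \<longlonglongrightarrow> 0"
          "\<And>t. (\<lambda>k. N (u' (t - s (r1 k)) - u t)) \<longlonglongrightarrow> 0"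
        using AA_subsequence[OF u, where s=s] by blast
      \<comment> \<open>The second subsequence is taken from the first, so that both functions have
        limits along \<open>r1 \<circ> r2\<close>.\<close>
      obtain r2 v' where r2: "strict_mono (r2 :: nat \<Rightarrow> nat)" and v': "\<And>t. v' t \<in> E"
        and lim2: "\<And>t. (\<lambda>k. N (v (t + (s \<circ> r1) (r2 k)) - v' t)) \<longlonglongrightarrow> 0"
          "\<And>t. (\<lambda>k. N (v' (t - (s \<circ> r1) (r2 k)) - v t)) \<longlonglongrightarrow> 0"
        using AA_subsequence[OF v, where s="s \<circ> r1"] by blast
      have sum: "(\<lambda>k. N ((f k + g k) - (a + b))) \<longlonglongrightarrow> 0"
        if "(\<lambda>k. N (f k - a)) \<longlonglongrightarrow> 0" "(\<lambda>k. N (g k - b)) \<longlonglongrightarrow> 0"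
          "\<And>k. f k \<in> E" "\<And>k. g k \<in> E" "a \<in> E" "b \<in> E" for f g a b
      proof (rule Lim_null_comparison)
        show "\<forall>\<^sub>F k in sequentially. norm (N ((f k + g k) - (a + b))) \<le> N (f k - a) + N (g k - b)"
          using that norm_add_diff_add_le by (auto simp: norm_nonneg diff_mem add_mem)
        show "(\<lambda>k. N (f k - a) + N (g k - b)) \<longlonglongrightarrow> 0"
          using that by (intro tendsto_add_zero)
      qed
      have "strict_mono (r1 \<circ> r2)"
        using r1 r2 by (rule strict_mono_o)
      moreover have "range (u' + v') \<subseteq> E"
        using u' v' by (auto simp: add_mem)
      moreover have "(\<lambda>k. N ((u + v) (t + s ((r1 \<circ> r2) k)) - (u' + v') t)) \<longlonglongrightarrow> 0" for t
        using sum[OF LIMSEQ_subseq_LIMSEQ[OF lim1(1) r2, unfolded o_def] lim2(1)[unfolded o_def]]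
        by (simp add: mem[OF u] mem[OF v] u' v')
      moreover have "(\<lambda>k. N ((u' + v') (t - s ((r1 \<circ> r2) k)) - (u + v) t)) \<longlonglongrightarrow> 0" for t
        using sum[OF LIMSEQ_subseq_LIMSEQ[OF lim1(2) r2, unfolded o_def] lim2(2)[unfolded o_def]]
        by (simp add: mem[OF u] mem[OF v] u' v')
      ultimately show ?thesis by blast
    qed
    then show ?thesis
      using u v continuous_map_norm_metric_add by (auto simp: AA_iff)
  qed
  have scale: "c *\<^sub>R u \<in> AA E N" if u: "u \<in> AA E N" for c u
  proof -
    have "\<exists>r. strict_mono r \<and> (\<exists>w. range w \<subseteq> E \<and> (\<forall>t.
        (\<lambda>k. N ((c *\<^sub>R u) (t + s (r k)) - w t)) \<longlonglongrightarrow> 0 \<and> (\<lambda>k. N (w (t - s (r k)) - (c *\<^sub>R u) t)) \<longlonglongrightarrow> 0))"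
      for s :: "nat \<Rightarrow> real"
    proof -
      obtain r v where r: "strict_mono (r :: nat \<Rightarrow> nat)" and v: "\<And>t. v t \<in> E"
        and lim: "\<And>t. (\<lambda>k. N (u (t + s (r k)) - v t)) \<longlonglongrightarrow> 0"
          "\<And>t. (\<lambda>k. N (v (t - s (r k)) - u t)) \<longlonglongrightarrow> 0"
        using AA_subsequence[OF u, where s=s] by blast
      show ?thesis
        using r lim
        by (intro exI[of _ r] exI[of _ "c *\<^sub>R v"] conjI allI)
          (auto simp: norm_scale_diff_scale mem[OF u] v scale_mem intro!: tendsto_mult_right_zero)
    qed
    then show ?thesis
      using u continuous_map_norm_metric_scale by (auto simp: AA_iff)
  qed
  show ?thesis
    by (simp add: subspace_def 0 add scale)
qed

end

section \<open>Translations in Bochner spaces on the line\<close>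

text \<open>The expression that \<open>Lp_norm\<close> becomes under \<open>transfer\<close>, over
  an arbitrary measure so that intervals and the whole line are handled together.\<close>

definition Bochner_norm :: "'b measure \<Rightarrow> real \<Rightarrow> ('b \<Rightarrow> 'a::real_normed_vector) \<Rightarrow> real" where
  "Bochner_norm M p f = (\<integral>x. norm (f x) powr p \<partial>M) powr (1 / p)"

lemma Bochner_norm_nonneg: "0 \<le> Bochner_norm M p f"
  by (simp add: Bochner_norm_def)

lemma (in complete_measure) Bochner_norm_AE_cong:
  assumes "AE x in M. f x = g x"
  shows "Bochner_norm M p f = Bochner_norm M p g"
proof -
  have "AE x in M. norm (f x) powr p = norm (g x) powr p"
    using assms by eventually_elim simp
  then show ?thesis
    by (simp add: Bochner_norm_def integral_AE_cong_complete(2))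
qed

lemma Bochner_p_integrable_scaleR:
  "Bochner_p_integrable M p f \<Longrightarrow> Bochner_p_integrable M p (\<lambda>x. c *\<^sub>R f x)"
  by (simp add: Bochner_p_integrable_def powr_mult strongly_measurable_scaleR)

lemma (in complete_measure) Bochner_p_integrable_zero: "Bochner_p_integrable M p (\<lambda>_. 0)"
  by (auto simp: Bochner_p_integrable_def strongly_measurable_def intro!: exI[of _ "\<lambda>_ _. 0"])

lemma (in complete_measure) Bochner_p_integrable_diff:
  assumes "1 \<le> p" "Bochner_p_integrable M p f" "Bochner_p_integrable M p g"
  shows "Bochner_p_integrable M p (\<lambda>x. f x - g x)"
  using Bochner_p_Minkowski(1)[OF assms(1,2) Bochner_p_integrable_scaleR[OF assms(3), of "-1"]] by simp

lemma (in complete_measure) Bochner_p_integrable_sum: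
  assumes "1 \<le> p" "\<And>i. i \<in> I \<Longrightarrow> Bochner_p_integrable M p (f i)"
  shows "Bochner_p_integrable M p (\<lambda>x. \<Sum>i\<in>I. f i x)"
  using assms(2)
  by (induction I rule: infinite_finite_induct)
    (simp_all add: Bochner_p_integrable_zero Bochner_p_Minkowski(1)[OF assms(1)])

lemma (in complete_measure) Bochner_norm_triangle:
  assumes "1 \<le> p" "Bochner_p_integrable M p f" "Bochner_p_integrable M p g"
  shows "Bochner_norm M p (\<lambda>x. f x + g x) \<le> Bochner_norm M p f + Bochner_norm M p g"
  using Bochner_p_Minkowski(2)[OF assms] by (simp add: Bochner_norm_def)

lemma strongly_measurable_indicator:
  assumes "strongly_measurable M f" "S \<in> sets M"
  shows "strongly_measurable M (\<lambda>x. indicator S x *\<^sub>R f x)"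
proof -
  obtain s where s: "\<And>i. simple_function M (s i)" "AE x in M. (\<lambda>i. s i x) \<longlonglongrightarrow> f x"
    using assms(1) by (auto simp: strongly_measurable_def)
  have "simple_function M (\<lambda>x. indicator S x *\<^sub>R s i x)" for i
    using assms(2) s(1) by (intro simple_function_compose2[where h="(*\<^sub>R)"]) auto
  moreover have "AE x in M. (\<lambda>i. indicator S x *\<^sub>R s i x) \<longlonglongrightarrow> indicator S x *\<^sub>R f x"
    using s(2) by eventually_elim (intro tendsto_intros)
  ultimately show ?thesis
    by (auto simp: strongly_measurable_def intro!: exI[of _ "\<lambda>i x. indicator S x *\<^sub>R s i x"])
qed

text \<open>Valid for every real \<open>p\<close>, since \<open>0 powr p = 0\<close>. The right side
  is written with \<open>scaleR\<close> to fit integration over a restricted space.\<close>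

lemma norm_indicator_powr:
  "norm (indicator S x *\<^sub>R y) powr p = indicator S x *\<^sub>R (norm y powr p)"
  by (simp split: split_indicator)

lemma Bochner_p_integrable_indicator:
  assumes "Bochner_p_integrable M p f" "S \<in> sets M"
  shows "Bochner_p_integrable M p (\<lambda>x. indicator S x *\<^sub>R f x)"
  using assms unfolding Bochner_p_integrable_def norm_indicator_powr
  by (intro conjI strongly_measurable_indicator integrable_mult_indicator) simp_all

lemma Bochner_norm_indicator_le:
  assumes "0 < p" "Bochner_p_integrable M p f" "S \<in> sets M"
  shows "Bochner_norm M p (\<lambda>x. indicator S x *\<^sub>R f x) \<le> Bochner_norm M p f"
  unfolding Bochner_norm_def norm_indicator_powr
proof (rule powr_mono2)
  show "(\<integral>x. indicator S x *\<^sub>R norm (f x) powr p \<partial>M) \<le> (\<integral>x. norm (f x) powr p \<partial>M)"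
    using assms unfolding Bochner_p_integrable_def
    by (intro integral_mono integrable_mult_indicator) (auto split: split_indicator)
qed (use assms(1) in \<open>auto intro!: Bochner_Integration.integral_nonneg\<close>)

text \<open>Here and in the next two lemmas, functions on an interval are traded for their
  extensions by zero, on which translations of the line act.\<close>

lemma strongly_measurable_restrict_space:
  assumes S: "S \<in> sets M"
  shows "strongly_measurable (restrict_space M S) f \<longleftrightarrow> strongly_measurable M (\<lambda>x. indicator S x *\<^sub>R f x)"
proof
  have S': "S \<inter> space M \<in> sets M" using S by auto
  assume "strongly_measurable (restrict_space M S) f"
  then obtain s where s: "\<And>i. simple_function M (\<lambda>x. indicator S x *\<^sub>R s i x)"
    "AE x in M. x \<in> S \<longrightarrow> (\<lambda>i. s i x) \<longlonglongrightarrow> f x"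
    using S' by (auto simp: strongly_measurable_def simple_function_restrict_space AE_restrict_space_iff)
  have "AE x in M. (\<lambda>i. indicator S x *\<^sub>R s i x) \<longlonglongrightarrow> indicator S x *\<^sub>R f x"
    using s(2) by eventually_elim (auto split: split_indicator)
  with s(1) show "strongly_measurable M (\<lambda>x. indicator S x *\<^sub>R f x)"
    by (auto simp: strongly_measurable_def intro!: exI[of _ "\<lambda>i x. indicator S x *\<^sub>R s i x"])
next
  have S': "S \<inter> space M \<in> sets M" using S by auto
  assume "strongly_measurable M (\<lambda>x. indicator S x *\<^sub>R f x)"
  then obtain s where s: "\<And>i. simple_function M (s i)"
    "AE x in M. (\<lambda>i. s i x) \<longlonglongrightarrow> indicator S x *\<^sub>R f x"
    by (auto simp: strongly_measurable_def)
  have "simple_function (restrict_space M S) (s i)" for i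
    using S S' s(1) by (simp add: simple_function_restrict_space simple_function_compose2[where h="(*\<^sub>R)"])
  moreover have "AE x in restrict_space M S. (\<lambda>i. s i x) \<longlonglongrightarrow> f x"
    unfolding AE_restrict_space_iff[OF S'] using s(2) by eventually_elim auto
  ultimately show "strongly_measurable (restrict_space M S) f"
    by (auto simp: strongly_measurable_def)
qed

lemma Bochner_p_integrable_restrict_space:
  assumes "S \<in> sets M"
  shows "Bochner_p_integrable (restrict_space M S) p f \<longleftrightarrow>
    Bochner_p_integrable M p (\<lambda>x. indicator S x *\<^sub>R f x)"
proof -
  have "S \<inter> space M \<in> sets M" using assms by auto
  then show ?thesis
    unfolding Bochner_p_integrable_def norm_indicator_powr
    by (simp add: strongly_measurable_restrict_space[OF assms] integrable_restrict_space)
qed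

lemma Bochner_norm_restrict_space:
  assumes "S \<in> sets M"
  shows "Bochner_norm (restrict_space M S) p f = Bochner_norm M p (\<lambda>x. indicator S x *\<^sub>R f x)"
proof -
  have "S \<inter> space M \<in> sets M" using assms by auto
  then show ?thesis
    unfolding Bochner_norm_def norm_indicator_powr by (simp add: integral_restrict_space)
qed

section \<open>Invariance under translations of the line\<close>

lemma measurable_lebesgue_shift: "(\<lambda>x. c + x :: real) \<in> lebesgue \<rightarrow>\<^sub>M lebesgue"
  using lebesgue_affine_measurable[where c="\<lambda>_::real. 1" and t=c] by simp

lemma distr_lebesgue_shift: "distr lebesgue lebesgue (\<lambda>x. c + x :: real) = lebesgue"
  using lebesgue_real_affine[of 1 c] by (simp add: density_1)

lemma Bochner_p_integrable_shift:
  assumes "Bochner_p_integrable lebesgue p f"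
  shows "Bochner_p_integrable lebesgue p (\<lambda>x. f (c + x :: real))"
proof -
  obtain s where s: "\<And>i. simple_function lebesgue (s i)" "AE x in lebesgue. (\<lambda>i. s i x) \<longlonglongrightarrow> f x"
    using assms by (auto simp: Bochner_p_integrable_def strongly_measurable_def)
  have "simple_function lebesgue (\<lambda>x. s i (c + x))" for i
    by (rule simple_function_comp[OF measurable_lebesgue_shift s(1)])
  moreover have "AE x in lebesgue. (\<lambda>i. s i (c + x)) \<longlonglongrightarrow> f (c + x)"
    by (rule AE_lebesgue_shift[OF s(2)])
  ultimately have "strongly_measurable lebesgue (\<lambda>x. f (c + x))"
    by (auto simp: strongly_measurable_def intro!: exI[of _ "\<lambda>i x. s i (c + x)"])
  moreover have "integrable lebesgue (\<lambda>x. norm (f (c + x)) powr p)"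
    using assms integrable_distr[OF measurable_lebesgue_shift, of c "\<lambda>x. norm (f x) powr p"]
    by (simp add: Bochner_p_integrable_def distr_lebesgue_shift)
  ultimately show ?thesis
    by (simp add: Bochner_p_integrable_def)
qed

lemma Bochner_norm_shift:
  assumes "Bochner_p_integrable lebesgue p f"
  shows "Bochner_norm lebesgue p (\<lambda>x. f (c + x :: real)) = Bochner_norm lebesgue p f"
proof -
  have "(\<lambda>x. norm (f x) powr p) \<in> borel_measurable lebesgue"
    using assms by (auto simp: Bochner_p_integrable_def)
  then show ?thesis
    using integral_distr[OF measurable_lebesgue_shift, of "\<lambda>x. norm (f x) powr p" c]
    by (simp add: Bochner_norm_def distr_lebesgue_shift)
qed

section \<open>Continuity of translations in the p-th mean\<close>

lemma
  fixes B :: "real set"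
  shows lmeasurable_vimage_shift: "B \<in> lmeasurable \<Longrightarrow> (+) h -` B \<in> lmeasurable"
    and measure_vimage_shift: "measure lebesgue ((+) h -` B) = measure lebesgue B"
proof -
  have "(+) h -` B = (+) (- h) ` B"
    by (auto simp: image_iff intro!: bexI[of _ "h + _"])
  then show "B \<in> lmeasurable \<Longrightarrow> (+) h -` B \<in> lmeasurable"
    and "measure lebesgue ((+) h -` B) = measure lebesgue B"
    by (simp_all only: measurable_translation measure_translation)
qed

text \<open>Squeeze \<open>A\<close> between a compact \<open>K\<close> and an open
  \<open>U\<close>. A shift shorter than the distance from \<open>K\<close> to the complement of
  \<open>U\<close> keeps \<open>K\<close> inside \<open>U\<close>, so if exactly one of
  \<open>x\<close> and \<open>h + x\<close> lies in \<open>A\<close>, one of the two points lies in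
  \<open>A - K\<close> or \<open>U - A\<close>. These two sets and their preimages are the four
  pieces, each of measure below \<open>e / 4\<close>.\<close>

lemma measure_translate_difference_tendsto:
  fixes A :: "real set"
  assumes A: "A \<in> sets lebesgue" "bounded A"
  shows "((\<lambda>h. measure lebesgue {x. (h + x \<in> A) \<noteq> (x \<in> A)}) \<longlongrightarrow> 0) (nhds 0)"
proof (rule tendstoI)
  fix e :: real assume e: "0 < e"
  obtain U where U: "open U" "A \<subseteq> U" "U - A \<in> lmeasurable" "emeasure lebesgue (U - A) < ennreal (e / 4)"
    using sets_lebesgue_outer_open[OF A(1), of "e / 4"] e by auto
  obtain K where K: "closed K" "K \<subseteq> A" "A - K \<in> lmeasurable" "emeasure lebesgue (A - K) < ennreal (e / 4)"
    using sets_lebesgue_inner_closed[OF A(1), of "e / 4"] e by auto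
  have "compact K"
    using K(1) bounded_subset[OF A(2) K(2)] by (simp add: compact_eq_bounded_closed)
  moreover have "closed (- U)" "K \<inter> - U = {}"
    using U(1,2) K(2) by auto
  ultimately obtain d where d: "0 < d" "\<And>x y. x \<in> K \<Longrightarrow> y \<in> - U \<Longrightarrow> d \<le> dist x y"
    using separate_compact_closed[of K "- U"] by blast
  have "measure lebesgue {x. (h + x \<in> A) \<noteq> (x \<in> A)} < e" if h: "\<bar>h\<bar> < d" for h
  proof -
    have KU: "y \<in> U" if "x \<in> K" "dist x y = \<bar>h\<bar>" for x y
      using d(2)[OF that(1), of y] that(2) h by force
    let ?D = "((A - K) \<union> (U - A)) \<union> (((+) h -` (A - K)) \<union> ((+) h -` (U - A)))"
    have "{x. (h + x \<in> A) \<noteq> (x \<in> A)} = ((+) h -` A - A) \<union> (A - (+) h -` A)"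
      by auto
    also have "\<dots> \<in> sets lebesgue"
      using A(1) measurable_sets[OF measurable_lebesgue_shift A(1), of h] by auto
    finally have "measure lebesgue {x. (h + x \<in> A) \<noteq> (x \<in> A)} \<le> measure lebesgue ?D"
    proof (rule measure_mono_fmeasurable[rotated])
      show "{x. (h + x \<in> A) \<noteq> (x \<in> A)} \<subseteq> ?D"
        using KU[of "h + _" _] KU[of _ "h + _"] by (auto simp: dist_real_def)
      show "?D \<in> lmeasurable"
        using U(3) K(3) by (intro fmeasurable.Un lmeasurable_vimage_shift) auto
    qed
    also have "\<dots> \<le> (measure lebesgue (A - K) + measure lebesgue (U - A)) +
        (measure lebesgue ((+) h -` (A - K)) + measure lebesgue ((+) h -` (U - A)))"
      using U(3) K(3)
      by (intro order_trans[OF measure_Un_le] add_mono measure_Un_le fmeasurableD fmeasurable.Un lmeasurable_vimage_shift) auto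
    also have "\<dots> < e"
      using U(3,4) K(3,4) e by (simp add: measure_vimage_shift emeasure_eq_measure2 ennreal_less_iff)
    finally show ?thesis .
  qed
  then show "\<forall>\<^sub>F h in nhds 0. dist (measure lebesgue {x. (h + x \<in> A) \<noteq> (x \<in> A)}) 0 < e"
    using d(1) by (auto simp: eventually_nhds_metric dist_real_def)
qed

text \<open>Integrability is included so that Minkowski's inequality gives closure under sums at
  once.\<close>

definition translation_continuous :: "real \<Rightarrow> (real \<Rightarrow> 'a::real_normed_vector) \<Rightarrow> bool" where
  "translation_continuous p f \<longleftrightarrow> Bochner_p_integrable lebesgue p f \<and>
     ((\<lambda>h. Bochner_norm lebesgue p (\<lambda>x. f (h + x) - f x)) \<longlongrightarrow> 0) (nhds 0)"

text \<open>The difference of the two functions has norm \<open>norm c\<close> exactly on the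
  symmetric difference of \<open>A\<close> and its translate, and is 0 elsewhere.\<close>

lemma translation_continuous_indicator:
  assumes p: "1 \<le> p" and A: "A \<in> sets lebesgue" "bounded A"
  shows "translation_continuous p (\<lambda>x. indicator A x *\<^sub>R c)"
proof -
  have lm: "A \<in> lmeasurable"
    using A by (simp add: bounded_set_imp_lmeasurable)
  have "Bochner_p_integrable lebesgue p (\<lambda>x. indicator A x *\<^sub>R c)"
  proof -
    have "simple_function lebesgue (\<lambda>x. indicator A x *\<^sub>R c)"
      using A by (intro simple_function_compose1[where g="\<lambda>r. r *\<^sub>R c"]) auto
    then have "strongly_measurable lebesgue (\<lambda>x. indicator A x *\<^sub>R c)"
      unfolding strongly_measurable_def by (intro exI[of _ "\<lambda>_ x. indicator A x *\<^sub>R c"]) auto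
    moreover have "integrable lebesgue (\<lambda>x. indicator A x *\<^sub>R (norm c powr p))"
      using lm by (simp add: lmeasurable_iff_integrable)
    ultimately show ?thesis
      unfolding Bochner_p_integrable_def norm_indicator_powr by blast
  qed
  moreover have "((\<lambda>h. Bochner_norm lebesgue p (\<lambda>x. indicator A (h + x) *\<^sub>R c - indicator A x *\<^sub>R c)) \<longlongrightarrow> 0) (nhds 0)"
  proof -
    let ?D = "\<lambda>h. {x. (h + x \<in> A) \<noteq> (x \<in> A)}"
    have D: "?D h \<in> lmeasurable" for h
    proof -
      have "(+) h -` A \<in> lmeasurable"
        by (rule lmeasurable_vimage_shift[OF lm])
      moreover have "?D h = ((+) h -` A - A) \<union> (A - (+) h -` A)"
        by auto
      ultimately show ?thesis
        using lm by (simp add: fmeasurable.Un fmeasurable.Diff)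
    qed
    have "norm (indicator A (h + x) *\<^sub>R c - indicator A x *\<^sub>R c) powr p = indicator (?D h) x * norm c powr p" for h x
      by (auto split: split_indicator)
    then have "Bochner_norm lebesgue p (\<lambda>x. indicator A (h + x) *\<^sub>R c - indicator A x *\<^sub>R c) =
        (measure lebesgue (?D h) * norm c powr p) powr (1 / p)" for h
      using D[of h] by (simp add: Bochner_norm_def)
    moreover have "((\<lambda>h. (measure lebesgue (?D h) * norm c powr p) powr (1 / p)) \<longlongrightarrow> 0) (nhds 0)"
      using p measure_translate_difference_tendsto[OF A]
      by (intro tendsto_zero_powrI[where b="1 / p"] tendsto_mult_left_zero tendsto_const always_eventually) auto
    ultimately show ?thesis by simp
  qed
  ultimately show ?thesis
    by (simp add: translation_continuous_def)
qed

lemma translation_continuous_add: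
  assumes p: "1 \<le> p" and f: "translation_continuous p f" and g: "translation_continuous p g"
  shows "translation_continuous p (\<lambda>x. f x + g x)"
proof -
  have I: "Bochner_p_integrable lebesgue p f" "Bochner_p_integrable lebesgue p g"
    using f g by (auto simp: translation_continuous_def)
  have "((\<lambda>h. Bochner_norm lebesgue p (\<lambda>x. (f (h + x) + g (h + x)) - (f x + g x))) \<longlongrightarrow> 0) (nhds 0)"
  proof (rule Lim_null_comparison[OF always_eventually], rule allI)
    show "((\<lambda>h. Bochner_norm lebesgue p (\<lambda>x. f (h + x) - f x) + Bochner_norm lebesgue p (\<lambda>x. g (h + x) - g x)) \<longlongrightarrow> 0) (nhds 0)"
      using f g by (intro tendsto_add_zero) (auto simp: translation_continuous_def)
    fix h
    have "Bochner_norm lebesgue p (\<lambda>x. (f (h + x) - f x) + (g (h + x) - g x)) \<le>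
        Bochner_norm lebesgue p (\<lambda>x. f (h + x) - f x) + Bochner_norm lebesgue p (\<lambda>x. g (h + x) - g x)"
      using I p by (intro completion.Bochner_norm_triangle completion.Bochner_p_integrable_diff Bochner_p_integrable_shift)
    then show "norm (Bochner_norm lebesgue p (\<lambda>x. (f (h + x) + g (h + x)) - (f x + g x))) \<le>
        Bochner_norm lebesgue p (\<lambda>x. f (h + x) - f x) + Bochner_norm lebesgue p (\<lambda>x. g (h + x) - g x)"
      by (simp add: Bochner_norm_nonneg algebra_simps)
  qed
  then show ?thesis
    using I p by (simp add: translation_continuous_def completion.Bochner_p_Minkowski(1))
qed

lemma translation_continuous_sum:
  assumes "1 \<le> p" "finite I" "\<And>i. i \<in> I \<Longrightarrow> translation_continuous p (f i)"
  shows "translation_continuous p (\<lambda>x. \<Sum>i\<in>I. f i x)"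
  using assms(2,3)
proof (induction I rule: finite_induct)
  case empty
  show ?case
    using translation_continuous_indicator[OF assms(1), of "{}" 0] by simp
next
  case (insert i I)
  then show ?case
    by (simp add: translation_continuous_add[OF assms(1)])
qed

lemma translation_continuous_simple_function:
  assumes p: "1 \<le> p" and s: "simple_function lebesgue s" and A: "A \<in> sets lebesgue" "bounded A"
  shows "translation_continuous p (\<lambda>x. indicator A x *\<^sub>R s x)"
proof -
  have fin: "finite (range s)" and sets: "s -` {y} \<in> sets lebesgue" for y
    using simple_functionD[OF s] by auto
  have "translation_continuous p (\<lambda>x. \<Sum>y\<in>range s. indicator (A \<inter> s -` {y}) x *\<^sub>R y)"
    using A sets bounded_subset[OF A(2)]
    by (intro translation_continuous_sum[OF p fin] translation_continuous_indicator[OF p]) auto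
  moreover have "(\<Sum>y\<in>range s. indicator (A \<inter> s -` {y}) x *\<^sub>R y) = indicator A x *\<^sub>R s x" for x
  proof -
    have "(\<Sum>y\<in>range s. indicator (A \<inter> s -` {y}) x *\<^sub>R y) =
        (\<Sum>y\<in>range s. if y = s x then indicator A x *\<^sub>R y else 0)"
      by (intro sum.cong) (auto split: split_indicator)
    then show ?thesis
      using fin by (simp add: sum.delta)
  qed
  ultimately show ?thesis by simp
qed

text \<open>Cutting the approximating simple functions off where they exceed \<open>2 \<parallel>f\<parallel>\<close> makes
  dominated convergence applicable.\<close>

lemma Bochner_p_integrable_approx:
  assumes p: "1 \<le> p" and f: "Bochner_p_integrable lebesgue p f" and e: "0 < e"
  obtains g where "translation_continuous p g" "Bochner_norm lebesgue p (\<lambda>x. f x - g x) < e"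
proof -
  obtain s where s: "\<And>i. simple_function lebesgue (s i)" "AE x in lebesgue. (\<lambda>i. s i x) \<longlonglongrightarrow> f x"
    using f by (auto simp: Bochner_p_integrable_def strongly_measurable_def)
  have int: "integrable lebesgue (\<lambda>x. norm (f x) powr p)" and sm: "strongly_measurable lebesgue f"
    using f by (auto simp: Bochner_p_integrable_def)
  have [measurable]: "(\<lambda>x. norm (f x)) \<in> borel_measurable lebesgue"
    by (rule completion.strongly_measurable_norm[OF sm])
  have [measurable]: "(\<lambda>x. norm (s i x)) \<in> borel_measurable lebesgue" for i
    by (rule borel_measurable_simple_function) (rule simple_function_compose1[OF s(1)])
  \<comment> \<open>Intersecting with \<open>{- real i..real i}\<close> makes the set bounded, as
    the result on simple functions requires.\<close>
  define A where "A i = {x \<in> space lebesgue. norm (s i x) \<le> 2 * norm (f x)} \<inter> {- real i..real i}" for i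
  have A: "A i \<in> sets lebesgue" "bounded (A i)" for i
  proof -
    have "{x \<in> space lebesgue. norm (s i x) \<le> 2 * norm (f x)} \<in> sets lebesgue"
      by measurable
    then show "A i \<in> sets lebesgue" by (simp add: A_def sets.Int)
    show "bounded (A i)"
      unfolding A_def by (rule bounded_subset[OF bounded_closed_interval]) auto
  qed
  define g where "g i x = indicator (A i) x *\<^sub>R s i x" for i x
  have g: "translation_continuous p (g i)" for i
    unfolding g_def by (rule translation_continuous_simple_function[OF p s(1) A])
  have lim: "AE x in lebesgue. (\<lambda>i. g i x) \<longlonglongrightarrow> f x"
    using s(2)
  proof eventually_elim
    fix x assume x: "(\<lambda>i. s i x) \<longlonglongrightarrow> f x"
    show "(\<lambda>i. g i x) \<longlonglongrightarrow> f x"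
    proof (cases "f x = 0")
      case True
      \<comment> \<open>Here \<open>s i x\<close> may be nonzero for every \<open>i\<close>; the
        cutoff removes it, since it requires \<open>norm (s i x) \<le> 0\<close>.\<close>
      then have "g i x = 0" for i
        by (auto simp: g_def A_def split: split_indicator)
      then show ?thesis using True by simp
    next
      case False
      have "\<forall>\<^sub>F i in sequentially. norm (s i x) < 2 * norm (f x)"
        using order_tendstoD(2)[OF tendsto_norm[OF x], of "2 * norm (f x)"] False by simp
      moreover have "\<forall>\<^sub>F i in sequentially. \<bar>x\<bar> \<le> real i"
        using filterlim_real_sequentially by (simp add: filterlim_at_top)
      ultimately have "\<forall>\<^sub>F i in sequentially. s i x = g i x"
        by eventually_elim (auto simp: g_def A_def indicator_def)
      then show ?thesis
        using x by (rule Lim_transform_eventually[rotated])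
    qed
  qed
  have gf: "norm (g i x) \<le> 2 * norm (f x)" for i x
    by (auto simp: g_def A_def split: split_indicator)
  have I: "Bochner_p_integrable lebesgue p (\<lambda>x. f x - g i x)" for i
    using g[of i] by (intro completion.Bochner_p_integrable_diff[OF p f]) (simp add: translation_continuous_def)
  \<comment> \<open>The majorant comes from
    \<open>norm (f x - g i x) \<le> norm (f x) + 2 * norm (f x)\<close>.\<close>
  have "(\<lambda>i. \<integral>x. norm (f x - g i x) powr p \<partial>lebesgue) \<longlonglongrightarrow> integral\<^sup>L lebesgue (\<lambda>_ :: real. 0)"
  proof (rule integral_dominated_convergence[where w="\<lambda>x. 3 powr p * norm (f x) powr p"])
    show "integrable lebesgue (\<lambda>x. 3 powr p * norm (f x) powr p)"
      using int by simp
    show "(\<lambda>x. norm (f x - g i x) powr p) \<in> borel_measurable lebesgue" for i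
      using I[of i] by (auto simp: Bochner_p_integrable_def)
    show "AE x in lebesgue. (\<lambda>i. norm (f x - g i x) powr p) \<longlonglongrightarrow> 0"
      using lim
    proof eventually_elim
      fix x assume "(\<lambda>i. g i x) \<longlonglongrightarrow> f x"
      then have "(\<lambda>i. norm (f x - g i x)) \<longlonglongrightarrow> 0"
        using tendsto_norm_zero[OF LIM_zero] by (simp add: norm_minus_commute)
      then show "(\<lambda>i. norm (f x - g i x) powr p) \<longlonglongrightarrow> 0"
        using p by (intro tendsto_zero_powrI[where b=p] tendsto_const always_eventually) auto
    qed
    show "AE x in lebesgue. norm (norm (f x - g i x) powr p) \<le> 3 powr p * norm (f x) powr p" for i
    proof (rule AE_I2)
      fix x
      have "norm (f x - g i x) \<le> 3 * norm (f x)"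
        using norm_triangle_ineq4[of "f x" "g i x"] gf[of i x] by simp
      then have "norm (f x - g i x) powr p \<le> (3 * norm (f x)) powr p"
        using p by (intro powr_mono2) auto
      then show "norm (norm (f x - g i x) powr p) \<le> 3 powr p * norm (f x) powr p"
        by (simp add: powr_mult)
    qed
  qed simp
  then have "(\<lambda>i. Bochner_norm lebesgue p (\<lambda>x. f x - g i x)) \<longlonglongrightarrow> 0"
    unfolding Bochner_norm_def using p
    by (intro tendsto_zero_powrI[where b="1 / p"] tendsto_const always_eventually) auto
  then obtain i where "Bochner_norm lebesgue p (\<lambda>x. f x - g i x) < e"
    using order_tendstoD(2)[OF _ e] eventually_happens'[OF sequentially_bot] by blast
  with g show thesis by (rule that)
qed

text \<open>With \<open>d = f - g\<close> for an approximant \<open>g\<close>, the difference splits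
  into \<open>d (h + x)\<close>, \<open>g (h + x) - g x\<close> and \<open>- d x\<close>. The two
  outer terms have the same norm by translation invariance, so each of the three is below
  \<open>e / 3\<close>.\<close>

lemma Bochner_p_integrable_translation_continuous:
  assumes p: "1 \<le> p" and f: "Bochner_p_integrable lebesgue p f"
  shows "translation_continuous p f"
proof -
  have "((\<lambda>h. Bochner_norm lebesgue p (\<lambda>x. f (h + x) - f x)) \<longlongrightarrow> 0) (nhds 0)"
  proof (rule tendstoI)
    fix e :: real assume "0 < e"
    then have e: "0 < e / 3" by simp
    obtain g where g: "translation_continuous p g" "Bochner_norm lebesgue p (\<lambda>x. f x - g x) < e / 3"
      using Bochner_p_integrable_approx[OF p f e] by blast
    have Ig: "Bochner_p_integrable lebesgue p g"
      and lim: "((\<lambda>h. Bochner_norm lebesgue p (\<lambda>x. g (h + x) - g x)) \<longlongrightarrow> 0) (nhds 0)"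
      using g(1) by (auto simp: translation_continuous_def)
    define d where "d x = f x - g x" for x
    have d: "Bochner_p_integrable lebesgue p d"
      unfolding d_def by (rule completion.Bochner_p_integrable_diff[OF p f Ig])
    have "\<forall>\<^sub>F h in nhds 0. Bochner_norm lebesgue p (\<lambda>x. g (h + x) - g x) < e / 3"
      using order_tendstoD(2)[OF lim e] .
    then show "\<forall>\<^sub>F h in nhds 0. dist (Bochner_norm lebesgue p (\<lambda>x. f (h + x) - f x)) 0 < e"
    proof eventually_elim
      fix h assume h: "Bochner_norm lebesgue p (\<lambda>x. g (h + x) - g x) < e / 3"
      have "Bochner_norm lebesgue p (\<lambda>x. f (h + x) - f x) =
          Bochner_norm lebesgue p (\<lambda>x. d (h + x) + ((g (h + x) - g x) + (- 1) *\<^sub>R d x))"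
        by (simp add: d_def)
      also have "\<dots> \<le> Bochner_norm lebesgue p (\<lambda>x. d (h + x)) +
          (Bochner_norm lebesgue p (\<lambda>x. g (h + x) - g x) + Bochner_norm lebesgue p (\<lambda>x. (- 1) *\<^sub>R d x))"
        by (intro order_trans[OF completion.Bochner_norm_triangle] add_left_mono
            completion.Bochner_norm_triangle completion.Bochner_p_Minkowski(1)
            completion.Bochner_p_integrable_diff Bochner_p_integrable_scaleR Bochner_p_integrable_shift p d Ig)
      also have "Bochner_norm lebesgue p (\<lambda>x. d (h + x)) = Bochner_norm lebesgue p d"
        by (rule Bochner_norm_shift[OF d])
      also have "Bochner_norm lebesgue p (\<lambda>x. (- 1) *\<^sub>R d x) = Bochner_norm lebesgue p d"
        by (simp add: Bochner_norm_def)
      finally show "dist (Bochner_norm lebesgue p (\<lambda>x. f (h + x) - f x)) 0 < e"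
        using h g(2) Bochner_norm_nonneg[of lebesgue p "\<lambda>x. f (h + x) - f x"] by (simp add: d_def[abs_def])
    qed
  qed
  with f show ?thesis
    by (simp add: translation_continuous_def)
qed

section \<open>The projection onto Bochner transforms\<close>

lemma bochner_transform_add: "bochner_transform (u + v) = bochner_transform u + bochner_transform v"
proof
  show "bochner_transform (u + v) t = (bochner_transform u + bochner_transform v) t" for t
    unfolding plus_fun_def by transfer simp
qed

lemma bochner_transform_scaleR: "bochner_transform (c *\<^sub>R u) = c *\<^sub>R bochner_transform u"
proof
  show "bochner_transform (c *\<^sub>R u) t = (c *\<^sub>R bochner_transform u) t" for t
    unfolding scaleR_fun_apply by transfer simp
qed

lemma bochner_left_inverse_add:
  "bochner_left_inverse (U + V) = bochner_left_inverse U + bochner_left_inverse V"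
  unfolding plus_fun_def by transfer simp

lemma bochner_left_inverse_scaleR: "bochner_left_inverse (c *\<^sub>R U) = c *\<^sub>R bochner_left_inverse U"
  unfolding scaleR_fun_def by transfer simp

lemma bochner_left_inverse_transform: "bochner_left_inverse (bochner_transform u) = u"
  by transfer (simp add: frac_def)

text \<open>On \<open>(n, n + 1)\<close> the function \<open>LU\<close> is \<open>U(n)\<close>
  translated by \<open>n\<close>. This makes the set \<open>M\<close> of the theorem the kernel of
  \<open>L\<close>.\<close>

lemma bochner_left_inverse_eq_0_iff:
  "bochner_left_inverse U = 0 \<longleftrightarrow> (\<forall>n::int. U (of_int n) = 0)"
proof
  have "bochner_left_inverse U = 0 \<Longrightarrow> U (of_int n) = 0" for n :: int
  proof transfer
    fix U :: "real \<Rightarrow> real \<Rightarrow> 'a" and n :: int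
    assume "AE t in lebesgue. U (of_int \<lfloor>t\<rfloor>) (frac t) = 0"
    from AE_lebesgue_shift[OF this, of "of_int n"]
    have "AE x in lebesgue. x \<in> {0<..<1} \<longrightarrow> U (of_int n) x = 0"
    proof eventually_elim
      fix x assume x: "U (of_int \<lfloor>of_int n + x\<rfloor>) (frac (of_int n + x)) = 0"
      show "x \<in> {0<..<1} \<longrightarrow> U (of_int n) x = 0"
      proof
        assume "x \<in> {0<..<1}"
        then have "\<lfloor>of_int n + x\<rfloor> = n" by (simp add: floor_eq_iff)
        then show "U (of_int n) x = 0" using x by (simp add: frac_def)
      qed
    qed
    then show "AE x in lebesgue_on {0<..<1}. U (of_int n) x = 0"
      by (simp add: AE_restrict_space_iff)
  qed
  then show "\<forall>n::int. U (of_int n) = 0" if "bochner_left_inverse U = 0"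
    using that by blast
next
  assume "\<forall>n::int. U (of_int n) = 0"
  \<comment> \<open>Erasing the values off the integers does not change \<open>LU\<close> and turns
    \<open>U\<close> into the zero map. The union of countably many null sets is thus left to the
    well-definedness of \<open>bochner_left_inverse\<close>.\<close>
  then have "(\<lambda>t. if t \<in> \<int> then U t else 0) = (\<lambda>_. 0)"
    by (auto simp: fun_eq_iff Ints_def)
  moreover have "bochner_left_inverse U = bochner_left_inverse (\<lambda>t. if t \<in> \<int> then U t else 0)"
    by transfer simp
  moreover have "bochner_left_inverse (\<lambda>_. 0 :: 'a ae01) = 0"
    by transfer simp
  ultimately show "bochner_left_inverse U = 0" by simp
qed

definition bochner_projection :: "(real \<Rightarrow> 'a::real_normed_vector ae01) \<Rightarrow> real \<Rightarrow> 'a ae01" where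
  "bochner_projection U = bochner_transform (bochner_left_inverse U)"

lemma bochner_projection_diff:
  "bochner_projection (\<lambda>t. U t - V t) t = bochner_projection U t - bochner_projection V t"
  unfolding bochner_projection_def by transfer simp

text \<open>Adding the integer \<open>n\<close> moves the floor by \<open>n\<close> and keeps the
  fractional part, so the grid of unit cells is mapped to itself.\<close>

lemma bochner_projection_shift:
  "bochner_projection (\<lambda>t. U (t + of_int n)) t = bochner_projection U (t + of_int n)"
  unfolding bochner_projection_def
proof transfer
  fix U :: "real \<Rightarrow> real \<Rightarrow> 'a" and n :: int and t :: real
  have floor: "\<lfloor>t + of_int n + \<theta>\<rfloor> = \<lfloor>t + \<theta>\<rfloor> + n" for \<theta>
    using floor_add_int[of "t + \<theta>" n] by (simp add: ac_simps)
  moreover have "frac (t + of_int n + \<theta>) = frac (t + \<theta>)" for \<theta>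
    by (simp add: frac_def floor)
  ultimately show "AE \<theta> in lebesgue_on {0<..<1}. U (of_int \<lfloor>t + \<theta>\<rfloor> + of_int n) (frac (t + \<theta>)) =
      U (of_int \<lfloor>t + of_int n + \<theta>\<rfloor>) (frac (t + of_int n + \<theta>))"
    by simp
qed

text \<open>Off the integers \<open>LU\<close> is the sum of the integer translates of the \<open>U(n)\<close>, extended by zero
  outside \<open>(0,1)\<close>.\<close>

lemma floor_frac_eq_sum:
  fixes U :: "real \<Rightarrow> real \<Rightarrow> 'a::real_normed_vector"
  assumes "finite I" "\<lfloor>t\<rfloor> \<in> I" "t \<notin> \<int>"
  shows "U (of_int \<lfloor>t\<rfloor>) (frac t) =
    (\<Sum>n\<in>I. indicator {0<..<1} (- of_int n + t) *\<^sub>R U (of_int n) (- of_int n + t))"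
proof -
  have "indicator {0<..<1} (- of_int n + t) *\<^sub>R U (of_int n) (- of_int n + t) =
      (if n = \<lfloor>t\<rfloor> then U (of_int \<lfloor>t\<rfloor>) (frac t) else 0)" for n
  proof (cases "n = \<lfloor>t\<rfloor>")
    case True
    have "frac t \<in> {0<..<1}"
      using assms(3) frac_lt_1[of t] frac_gt_0_iff[of t] by simp
    then show ?thesis using True by (simp add: frac_def)
  next
    case False
    then have "- of_int n + t \<notin> {0<..<1}"
      using floor_unique[of n t] by auto
    then show ?thesis using False by simp
  qed
  then show ?thesis
    using assms(1,2) by simp
qed

lemma AE_lebesgue_not_Ints: "AE t :: real in lebesgue. c + t \<notin> \<int>"
proof -
  have "AE t :: real in lborel. t \<notin> \<int>"
    by (intro AE_not_in countable_imp_null_set_lborel countable_int)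
  then have "AE t :: real in lebesgue. t \<notin> \<int>"
    by (rule AE_completion)
  then show ?thesis by (rule AE_lebesgue_shift)
qed

lemma Bochner_p_integrable_unit_translate:
  assumes "Bochner_p_integrable (lebesgue_on {0<..<1}) p f"
  shows "Bochner_p_integrable lebesgue p (\<lambda>x. indicator {0<..<1} (c + x) *\<^sub>R f (c + x :: real))"
    and "Bochner_norm lebesgue p (\<lambda>x. indicator {0<..<1} (c + x) *\<^sub>R f (c + x)) =
      Bochner_norm (lebesgue_on {0<..<1}) p f"
proof -
  have f: "Bochner_p_integrable lebesgue p (\<lambda>x. indicator {0<..<1} x *\<^sub>R f x)"
    using assms by (simp add: Bochner_p_integrable_restrict_space)
  show "Bochner_p_integrable lebesgue p (\<lambda>x. indicator {0<..<1} (c + x) *\<^sub>R f (c + x))"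
    by (rule Bochner_p_integrable_shift[OF f])
  show "Bochner_norm lebesgue p (\<lambda>x. indicator {0<..<1} (c + x) *\<^sub>R f (c + x)) =
      Bochner_norm (lebesgue_on {0<..<1}) p f"
    using Bochner_norm_shift[OF f, of c] by (simp add: Bochner_norm_restrict_space)
qed

lemma in_Lp_loc_left_inverse:
  assumes p: "1 \<le> p" and U: "\<And>n::int. in_Lp p (U (of_int n))"
  shows "in_Lp_loc p (bochner_left_inverse U)"
proof -
  have "\<forall>n::int. in_Lp p (U (of_int n)) \<Longrightarrow> in_Lp_loc p (bochner_left_inverse U)"
    using p
  proof (transfer, intro allI impI)
    fix p :: real and U :: "real \<Rightarrow> real \<Rightarrow> 'a" and a b :: real
    assume p: "1 \<le> p" and U: "\<forall>n::int. Bochner_p_integrable (lebesgue_on {0<..<1}) p (U (of_int n))"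
    \<comment> \<open>These indices contain the floor of every \<open>t\<close> in
      \<open>(a, b)\<close>, so \<open>S\<close> agrees with \<open>LU\<close> almost everywhere
      there and is integrable over the whole line.\<close>
    define S where "S t = (\<Sum>n\<in>{\<lfloor>a\<rfloor>..\<lfloor>b\<rfloor>}. indicator {0<..<1} (- of_int n + t) *\<^sub>R U (of_int n) (- of_int n + t))" for t
    have S: "Bochner_p_integrable lebesgue p S"
      unfolding S_def using U
      by (intro completion.Bochner_p_integrable_sum[OF p] Bochner_p_integrable_unit_translate(1)) auto
    have "Bochner_p_integrable lebesgue p (\<lambda>t. indicator {a<..<b} t *\<^sub>R S t)"
      by (rule Bochner_p_integrable_indicator[OF S]) auto
    moreover have "AE t in lebesgue. indicator {a<..<b} t *\<^sub>R S t = indicator {a<..<b} t *\<^sub>R U (of_int \<lfloor>t\<rfloor>) (frac t)"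
      using AE_lebesgue_not_Ints[of 0]
    proof eventually_elim
      fix t :: real assume "0 + t \<notin> \<int>"
      then show "indicator {a<..<b} t *\<^sub>R S t = indicator {a<..<b} t *\<^sub>R U (of_int \<lfloor>t\<rfloor>) (frac t)"
        using floor_frac_eq_sum[of "{\<lfloor>a\<rfloor>..\<lfloor>b\<rfloor>}" t U]
        by (auto simp: S_def floor_mono split: split_indicator)
    qed
    ultimately have "Bochner_p_integrable lebesgue p (\<lambda>t. indicator {a<..<b} t *\<^sub>R U (of_int \<lfloor>t\<rfloor>) (frac t))"
      by (rule completion.Bochner_p_integrable_AE_cong[THEN iffD1, rotated])
    then show "Bochner_p_integrable (lebesgue_on {a<..<b}) p (\<lambda>t. U (of_int \<lfloor>t\<rfloor>) (frac t))"
      by (simp add: Bochner_p_integrable_restrict_space)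
  qed
  with U show ?thesis by blast
qed

text \<open>An interval \<open>(t, t + 1)\<close> meets only the two unit intervals starting at \<open>[t]\<close> and \<open>[t] + 1\<close>.\<close>

lemma Lp_norm_projection_le:
  assumes p: "1 \<le> p" and U: "\<And>n::int. in_Lp p (U (of_int n))"
  shows "Lp_norm p (bochner_projection U t) \<le>
    Lp_norm p (U (of_int \<lfloor>t\<rfloor>)) + Lp_norm p (U (of_int (\<lfloor>t\<rfloor> + 1)))"
proof -
  have "\<forall>n::int. in_Lp p (U (of_int n)) \<Longrightarrow> Lp_norm p (bochner_projection U t) \<le>
    Lp_norm p (U (of_int \<lfloor>t\<rfloor>)) + Lp_norm p (U (of_int (\<lfloor>t\<rfloor> + 1)))"
    using p unfolding bochner_projection_def
  proof (transfer, fold Bochner_norm_def)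
    fix p :: real and U :: "real \<Rightarrow> real \<Rightarrow> 'a" and t :: real
    assume p: "1 \<le> p" and U: "\<forall>n::int. Bochner_p_integrable (lebesgue_on {0<..<1}) p (U (of_int n))"
    define m where "m = \<lfloor>t\<rfloor>"
    \<comment> \<open>The piece coming from \<open>U(n)\<close>, extended by zero and seen from
      \<open>t\<close>; translation preserves its norm, so cutting it to \<open>(0,1)\<close> can
      only decrease it.\<close>
    define F where "F n x = indicator {0<..<1} ((t - of_int n) + x) *\<^sub>R U (of_int n) ((t - of_int n) + x)" for n x
    have F: "Bochner_p_integrable lebesgue p (F n)"
      "Bochner_norm lebesgue p (F n) = Bochner_norm (lebesgue_on {0<..<1}) p (U (of_int n))" for n
      unfolding F_def using U Bochner_p_integrable_unit_translate by blast+
    have sum: "Bochner_p_integrable lebesgue p (\<lambda>x. F m x + F (m + 1) x)"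
      using p F by (intro completion.Bochner_p_Minkowski(1))
    have "AE \<theta> in lebesgue. indicator {0<..<1} \<theta> *\<^sub>R U (of_int \<lfloor>t + \<theta>\<rfloor>) (frac (t + \<theta>)) =
        indicator {0<..<1} \<theta> *\<^sub>R (F m \<theta> + F (m + 1) \<theta>)"
      using AE_lebesgue_not_Ints[of t]
    proof eventually_elim
      fix \<theta> assume \<theta>: "t + \<theta> \<notin> \<int>"
      have "U (of_int \<lfloor>t + \<theta>\<rfloor>) (frac (t + \<theta>)) = F m \<theta> + F (m + 1) \<theta>" if "\<theta> \<in> {0<..<1}"
      proof -
        have shift: "(t - of_int n) + \<theta> = - of_int n + (t + \<theta>)" for n :: int
          by simp
        have F_\<theta>: "F n \<theta> = indicator {0<..<1} (- of_int n + (t + \<theta>)) *\<^sub>R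
            U (of_int n) (- of_int n + (t + \<theta>))" for n
          by (simp only: F_def shift)
        have "\<lfloor>t + \<theta>\<rfloor> \<in> {m, m + 1}"
          using that unfolding m_def by simp linarith
        then show ?thesis
          using floor_frac_eq_sum[of "{m, m + 1}" "t + \<theta>" U] \<theta> unfolding F_\<theta>[symmetric] by simp
      qed
      then show "indicator {0<..<1} \<theta> *\<^sub>R U (of_int \<lfloor>t + \<theta>\<rfloor>) (frac (t + \<theta>)) =
          indicator {0<..<1} \<theta> *\<^sub>R (F m \<theta> + F (m + 1) \<theta>)"
        by (simp split: split_indicator)
    qed
    then have "Bochner_norm (lebesgue_on {0<..<1}) p (\<lambda>\<theta>. U (of_int \<lfloor>t + \<theta>\<rfloor>) (frac (t + \<theta>))) =
        Bochner_norm lebesgue p (\<lambda>\<theta>. indicator {0<..<1} \<theta> *\<^sub>R (F m \<theta> + F (m + 1) \<theta>))"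
      by (simp add: Bochner_norm_restrict_space completion.Bochner_norm_AE_cong)
    also have "\<dots> \<le> Bochner_norm lebesgue p (\<lambda>x. F m x + F (m + 1) x)"
      using p by (intro Bochner_norm_indicator_le sum) auto
    also have "\<dots> \<le> Bochner_norm lebesgue p (F m) + Bochner_norm lebesgue p (F (m + 1))"
      by (rule completion.Bochner_norm_triangle[OF p F(1) F(1)])
    finally show "Bochner_norm (lebesgue_on {0<..<1}) p (\<lambda>\<theta>. U (of_int \<lfloor>t + \<theta>\<rfloor>) (frac (t + \<theta>))) \<le>
        Bochner_norm (lebesgue_on {0<..<1}) p (U (of_int \<lfloor>t\<rfloor>)) +
        Bochner_norm (lebesgue_on {0<..<1}) p (U (of_int (\<lfloor>t\<rfloor> + 1)))"
      by (simp only: F(2) m_def)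
  qed
  with U show ?thesis by blast
qed

section \<open>Values and continuity of the Bochner transform\<close>

lemma in_Lp_bochner_transform: "in_Lp_loc p u \<Longrightarrow> in_Lp p (bochner_transform u t)"
proof transfer
  fix p t and u :: "real \<Rightarrow> 'a"
  assume "\<forall>a b. a < b \<longrightarrow> Bochner_p_integrable (lebesgue_on {a<..<b}) p u"
  then have "Bochner_p_integrable (lebesgue_on {t<..<t + 1}) p u"
    by simp
  then have "Bochner_p_integrable lebesgue p (\<lambda>x. indicator {t<..<t + 1} x *\<^sub>R u x)"
    by (simp add: Bochner_p_integrable_restrict_space)
  from Bochner_p_integrable_shift[OF this, of t]
  show "Bochner_p_integrable (lebesgue_on {0<..<1}) p (\<lambda>\<theta>. u (t + \<theta>))"
    by (simp add: Bochner_p_integrable_restrict_space indicator_def)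
qed

lemma bochner_transform_tendsto:
  assumes "1 \<le> p" "in_Lp_loc p u"
  shows "((\<lambda>s. Lp_norm p (bochner_transform u s - bochner_transform u t)) \<longlongrightarrow> 0) (nhds t)"
  using assms
proof (transfer, fold Bochner_norm_def)
  fix p t and u :: "real \<Rightarrow> 'a"
  assume p: "1 \<le> p" and u: "\<forall>a b. a < b \<longrightarrow> Bochner_p_integrable (lebesgue_on {a<..<b}) p u"
  \<comment> \<open>For \<open>dist s t < 1\<close> both \<open>s + \<theta>\<close> and
    \<open>t + \<theta>\<close> stay in this window, so the merely local \<open>u\<close> can be
    replaced by a function integrable on the line.\<close>
  define G where "G x = indicator {t - 1<..<t + 2} x *\<^sub>R u x" for x
  have G: "Bochner_p_integrable lebesgue p G"
    using u[rule_format, of "t - 1" "t + 2"] by (simp add: G_def[abs_def] Bochner_p_integrable_restrict_space)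
  have Gd: "Bochner_p_integrable lebesgue p (\<lambda>x. G (h + x) - G x)" for h
    by (intro completion.Bochner_p_integrable_diff[OF p] Bochner_p_integrable_shift G)
  have bound: "Bochner_norm (lebesgue_on {0<..<1}) p (\<lambda>\<theta>. u (s + \<theta>) - u (t + \<theta>)) \<le>
      Bochner_norm lebesgue p (\<lambda>x. G ((s - t) + x) - G x)" if s: "dist s t < 1" for s
  proof -
    have "(\<lambda>\<theta>. indicator {0<..<1} \<theta> *\<^sub>R (u (s + \<theta>) - u (t + \<theta>))) =
        (\<lambda>\<theta>. indicator {0<..<1} \<theta> *\<^sub>R (G ((s - t) + (t + \<theta>)) - G (t + \<theta>)))"
      using s by (auto simp: G_def dist_real_def fun_eq_iff split: split_indicator)
    then have "Bochner_norm (lebesgue_on {0<..<1}) p (\<lambda>\<theta>. u (s + \<theta>) - u (t + \<theta>)) =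
        Bochner_norm lebesgue p (\<lambda>\<theta>. indicator {0<..<1} \<theta> *\<^sub>R (G ((s - t) + (t + \<theta>)) - G (t + \<theta>)))"
      by (simp add: Bochner_norm_restrict_space)
    also have "\<dots> \<le> Bochner_norm lebesgue p (\<lambda>\<theta>. G ((s - t) + (t + \<theta>)) - G (t + \<theta>))"
      using p by (intro Bochner_norm_indicator_le Bochner_p_integrable_shift[OF Gd]) auto
    also have "\<dots> = Bochner_norm lebesgue p (\<lambda>x. G ((s - t) + x) - G x)"
      by (rule Bochner_norm_shift[OF Gd])
    finally show ?thesis .
  qed
  have "((\<lambda>h. Bochner_norm lebesgue p (\<lambda>x. G (h + x) - G x)) \<longlongrightarrow> 0) (nhds 0)"
    using Bochner_p_integrable_translation_continuous[OF p G] by (simp add: translation_continuous_def)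
  moreover have "((\<lambda>s. s - t) \<longlongrightarrow> 0) (nhds t)"
    using tendsto_diff[OF filterlim_ident[of "nhds t"] tendsto_const[of t "nhds t"]] by simp
  ultimately have "((\<lambda>s. Bochner_norm lebesgue p (\<lambda>x. G ((s - t) + x) - G x)) \<longlongrightarrow> 0) (nhds t)"
    by (rule filterlim_compose)
  moreover have "\<forall>\<^sub>F s in nhds t. norm (Bochner_norm (lebesgue_on {0<..<1}) p (\<lambda>\<theta>. u (s + \<theta>) - u (t + \<theta>))) \<le>
      Bochner_norm lebesgue p (\<lambda>x. G ((s - t) + x) - G x)"
    unfolding eventually_nhds_metric using bound by (auto simp: Bochner_norm_nonneg intro!: exI[of _ 1])
  ultimately show "((\<lambda>s. Bochner_norm (lebesgue_on {0<..<1}) p (\<lambda>\<theta>. u (s + \<theta>) - u (t + \<theta>))) \<longlongrightarrow> 0) (nhds t)"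
    by (rule Lim_null_comparison[rotated])
qed

section \<open>The projection on the three classes of functions\<close>

context normed_carrier
begin

lemma norm_le_sup_norm:
  assumes "u \<in> BC E N"
  shows "N (u t) \<le> sup_norm N u"
  unfolding sup_norm_def using assms by (intro cSUP_upper) (auto simp: BC_iff bdd_above_def)

lemma sup_norm_nonneg:
  assumes "u \<in> BC E N"
  shows "0 \<le> sup_norm N u"
  using norm_nonneg[of "u 0"] norm_le_sup_norm[OF assms, of 0] assms
  by (auto simp: BC_iff image_subset_iff)

end

lemma sup_norm_le: "(\<And>t. N (u t) \<le> K) \<Longrightarrow> sup_norm N u \<le> K"
  unfolding sup_norm_def by (intro cSUP_least) auto

text \<open>Makes \<open>B\<close> isometric, so that a bound for the projection is at the same time
  a bound for \<open>L\<close>.\<close>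

lemma Sp_norm_eq_sup_norm: "Sp_norm p u = sup_norm (Lp_norm p) (bochner_transform u)"
  unfolding sup_norm_def by transfer simp

lemma continuous_map_bochner_transform:
  assumes "1 \<le> p" "in_Lp_loc p u"
  shows "continuous_map euclideanreal (mtopology_of (norm_metric (Lp p) (Lp_norm p))) (bochner_transform u)"
  unfolding normed_carrier.continuous_map_norm_metric[OF normed_carrier_Lp[OF assms(1)]]
  using in_Lp_bochner_transform[OF assms(2)] bochner_transform_tendsto[OF assms] by (auto simp: Lp_def)

lemma
  assumes "1 \<le> p" "\<And>n::int. U (of_int n) \<in> Lp p"
  shows continuous_map_bochner_projection:
      "continuous_map euclideanreal (mtopology_of (norm_metric (Lp p) (Lp_norm p))) (bochner_projection U)"
    and bochner_projection_in_Lp: "bochner_projection U t \<in> Lp p"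
proof -
  have u: "in_Lp_loc p (bochner_left_inverse U)"
    using assms by (intro in_Lp_loc_left_inverse) (simp_all add: Lp_def)
  show "continuous_map euclideanreal (mtopology_of (norm_metric (Lp p) (Lp_norm p))) (bochner_projection U)"
    unfolding bochner_projection_def by (rule continuous_map_bochner_transform[OF assms(1) u])
  show "bochner_projection U t \<in> Lp p"
    using in_Lp_bochner_transform[OF u] by (simp add: bochner_projection_def Lp_def)
qed

lemma Lp_norm_projection_bound:
  assumes p: "1 \<le> p" and U: "\<And>n::int. U (of_int n) \<in> Lp p" "\<And>n::int. Lp_norm p (U (of_int n)) \<le> K"
  shows "Lp_norm p (bochner_projection U t) \<le> 2 * K"
  using Lp_norm_projection_le[OF p, of U t] U(1) U(2)[of "\<lfloor>t\<rfloor>"] U(2)[of "\<lfloor>t\<rfloor> + 1"]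
  by (simp add: Lp_def)

text \<open>Split off \<open>bochner_projection (\<lambda>t. A k t - B t) (x k)\<close>, which
  depends on finitely many integers only, so pointwise convergence there is enough. What remains is
  the continuity of the projection of \<open>B\<close>, which holds even for discontinuous
  \<open>B\<close>.\<close>

lemma bochner_projection_tendsto:
  fixes A :: "nat \<Rightarrow> real \<Rightarrow> 'a::real_normed_vector ae01"
  assumes p: "1 \<le> p" and A: "\<And>k (n::int). A k (of_int n) \<in> Lp p" and B: "\<And>n::int. B (of_int n) \<in> Lp p"
    and AB: "\<And>n::int. (\<lambda>k. Lp_norm p (A k (of_int n) - B (of_int n))) \<longlonglongrightarrow> 0" and x: "x \<longlonglongrightarrow> x0"
  shows "(\<lambda>k. Lp_norm p (bochner_projection (A k) (x k) - bochner_projection B x0)) \<longlonglongrightarrow> 0"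
proof -
  interpret Lp: normed_carrier "Lp p :: 'a ae01 set" "Lp_norm p"
    by (rule normed_carrier_Lp[OF p])
  note mem = bochner_projection_in_Lp[OF p]
  define a where "a k n = Lp_norm p (A k (of_int n) - B (of_int n))" for k and n :: int
  have a_nonneg: "0 \<le> a k n" for k n
    unfolding a_def by (intro Lp.norm_nonneg Lp.diff_mem A B)
  \<comment> \<open>If \<open>x k\<close> is within 1 of \<open>x0\<close>, its floor lies between
    \<open>\<lfloor>x0\<rfloor> - 1\<close> and \<open>\<lfloor>x0\<rfloor> + 1\<close>; the
    successor of the floor accounts for the upper end.\<close>
  define J where "J = {\<lfloor>x0\<rfloor> - 1..\<lfloor>x0\<rfloor> + 2}"
  show ?thesis
  proof (rule Lim_null_comparison)
    have "(\<lambda>k. \<Sum>n\<in>J. a k n) \<longlonglongrightarrow> 0"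
      using AB by (intro tendsto_null_sum) (simp add: a_def)
    moreover have "(\<lambda>k. Lp_norm p (bochner_projection B (x k) - bochner_projection B x0)) \<longlonglongrightarrow> 0"
      by (rule Lp.continuous_map_norm_metric_tendsto[OF continuous_map_bochner_projection[of p B, OF p B] x])
    ultimately show "(\<lambda>k. (\<Sum>n\<in>J. a k n) + Lp_norm p (bochner_projection B (x k) - bochner_projection B x0)) \<longlonglongrightarrow> 0"
      by (rule tendsto_add_zero)
    have "\<forall>\<^sub>F k in sequentially. dist (x k) x0 < 1"
      using x by (simp add: tendsto_iff)
    then show "\<forall>\<^sub>F k in sequentially. norm (Lp_norm p (bochner_projection (A k) (x k) - bochner_projection B x0)) \<le>
        (\<Sum>n\<in>J. a k n) + Lp_norm p (bochner_projection B (x k) - bochner_projection B x0)"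
    proof eventually_elim
      fix k assume "dist (x k) x0 < 1"
      then have "{\<lfloor>x k\<rfloor>, \<lfloor>x k\<rfloor> + 1} \<subseteq> J"
        unfolding J_def dist_real_def by simp linarith
      then have "(\<Sum>n\<in>{\<lfloor>x k\<rfloor>, \<lfloor>x k\<rfloor> + 1}. a k n) \<le> (\<Sum>n\<in>J. a k n)"
        using a_nonneg by (intro sum_mono2) (auto simp: J_def)
      moreover have "Lp_norm p (bochner_projection (\<lambda>t. A k t - B t) (x k)) \<le> a k \<lfloor>x k\<rfloor> + a k (\<lfloor>x k\<rfloor> + 1)"
        unfolding a_def using Lp.diff_mem[OF A B] by (intro Lp_norm_projection_le[OF p]) (simp add: Lp_def)
      ultimately have "Lp_norm p (bochner_projection (A k) (x k) - bochner_projection B (x k)) \<le> (\<Sum>n\<in>J. a k n)"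
        by (simp add: bochner_projection_diff)
      moreover have "Lp_norm p (bochner_projection (A k) (x k) - bochner_projection B x0) \<le>
          Lp_norm p (bochner_projection (A k) (x k) - bochner_projection B (x k)) +
          Lp_norm p (bochner_projection B (x k) - bochner_projection B x0)"
        by (intro Lp.norm_diff_triangle mem A B)
      moreover have "0 \<le> Lp_norm p (bochner_projection (A k) (x k) - bochner_projection B x0)"
        by (intro Lp.norm_nonneg Lp.diff_mem mem A B)
      ultimately show "norm (Lp_norm p (bochner_projection (A k) (x k) - bochner_projection B x0)) \<le>
          (\<Sum>n\<in>J. a k n) + Lp_norm p (bochner_projection B (x k) - bochner_projection B x0)"
        by simp
    qed
  qed
qed

lemma BC_bochner_projection:
  fixes U :: "real \<Rightarrow> 'a::real_normed_vector ae01"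
  assumes p: "1 \<le> p" and U: "U \<in> BC (Lp p) (Lp_norm p)"
  shows "bochner_projection U \<in> BC (Lp p) (Lp_norm p)"
    and "sup_norm (Lp_norm p) (bochner_projection U) \<le> 2 * sup_norm (Lp_norm p) U"
proof -
  interpret Lp: normed_carrier "Lp p :: 'a ae01 set" "Lp_norm p"
    by (rule normed_carrier_Lp[OF p])
  have mem: "U t \<in> Lp p" for t
    using U by (auto simp: Lp.BC_iff)
  have bound: "Lp_norm p (bochner_projection U t) \<le> 2 * sup_norm (Lp_norm p) U" for t
    by (intro Lp_norm_projection_bound p mem Lp.norm_le_sup_norm U)
  have "continuous_map euclideanreal (mtopology_of (norm_metric (Lp p) (Lp_norm p))) (bochner_projection U)"
    by (intro continuous_map_bochner_projection p mem)
  then show "bochner_projection U \<in> BC (Lp p) (Lp_norm p)"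
    using bound by (auto simp: Lp.BC_iff Lp.continuous_map_norm_metric)
  show "sup_norm (Lp_norm p) (bochner_projection U) \<le> 2 * sup_norm (Lp_norm p) U"
    by (rule sup_norm_le) (rule bound)
qed

text \<open>An integer almost period of \<open>U\<close> is one of its projection, because the projection commutes
  with integer translations.\<close>

lemma AP_bochner_projection:
  fixes U :: "real \<Rightarrow> 'a::real_normed_vector ae01"
  assumes p: "1 \<le> p" and U: "U \<in> AP (Lp p) (Lp_norm p)"
  shows "bochner_projection U \<in> AP (Lp p) (Lp_norm p)"
proof -
  interpret Lp: normed_carrier "Lp p :: 'a ae01 set" "Lp_norm p"
    by (rule normed_carrier_Lp[OF p])
  have mem: "U t \<in> Lp p" for t
    using U by (auto simp: Lp.AP_iff Lp.continuous_map_norm_metric)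
  have "relatively_dense {\<tau>. \<forall>t. Lp_norm p (bochner_projection U (t + \<tau>) - bochner_projection U t) \<le> e}"
    if "0 < e" for e
  proof (rule relatively_dense_mono)
    \<comment> \<open>Half of \<open>e\<close>, because the projection can double a uniform
      bound.\<close>
    show "relatively_dense {\<tau> \<in> \<int>. \<forall>t. Lp_norm p (U (t + \<tau>) - U t) \<le> e / 2}"
      using that by (intro Lp.AP_Ints_almost_periods[OF U]) simp
    show "{\<tau> \<in> \<int>. \<forall>t. Lp_norm p (U (t + \<tau>) - U t) \<le> e / 2} \<subseteq>
        {\<tau>. \<forall>t. Lp_norm p (bochner_projection U (t + \<tau>) - bochner_projection U t) \<le> e}"
    proof safe
      fix \<tau> t assume "\<tau> \<in> \<int>" and \<tau>: "\<forall>t. Lp_norm p (U (t + \<tau>) - U t) \<le> e / 2"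
      then obtain n where n: "\<tau> = of_int n" by (auto elim: Ints_cases)
      have "Lp_norm p (bochner_projection (\<lambda>x. U (x + of_int n) - U x) t) \<le> 2 * (e / 2)"
        using \<tau> n by (intro Lp_norm_projection_bound p Lp.diff_mem mem) auto
      then show "Lp_norm p (bochner_projection U (t + \<tau>) - bochner_projection U t) \<le> e"
        by (simp add: bochner_projection_diff bochner_projection_shift n)
    qed
  qed
  moreover have "continuous_map euclideanreal (mtopology_of (norm_metric (Lp p) (Lp_norm p))) (bochner_projection U)"
    by (intro continuous_map_bochner_projection p mem)
  ultimately show ?thesis
    by (simp add: Lp.AP_iff)
qed

text \<open>Split the translation by \<open>s\<^sub>k\<close> into the translation by \<open>[s\<^sub>k]\<close>, which commutes with the
  projection, and the one by \<open>{s\<^sub>k}\<close>, which converges along a subsequence.\<close>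

lemma AA_bochner_projection:
  fixes U :: "real \<Rightarrow> 'a::real_normed_vector ae01"
  assumes p: "1 \<le> p" and U: "U \<in> AA (Lp p) (Lp_norm p)"
  shows "bochner_projection U \<in> AA (Lp p) (Lp_norm p)"
proof -
  interpret Lp: normed_carrier "Lp p :: 'a ae01 set" "Lp_norm p"
    by (rule normed_carrier_Lp[OF p])
  have mem: "U t \<in> Lp p" for t
    using U by (auto simp: Lp.AA_iff Lp.continuous_map_norm_metric)
  have "\<exists>r. strict_mono r \<and> (\<exists>w. range w \<subseteq> Lp p \<and> (\<forall>t.
      (\<lambda>k. Lp_norm p (bochner_projection U (t + s (r k)) - w t)) \<longlonglongrightarrow> 0 \<and>
      (\<lambda>k. Lp_norm p (w (t - s (r k)) - bochner_projection U t)) \<longlonglongrightarrow> 0))" for s :: "nat \<Rightarrow> real"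
  proof -
    \<comment> \<open>The closed interval is taken for compactness; the limit
      \<open>\<sigma>\<close> may well be 1.\<close>
    have "\<forall>k. frac (s k) \<in> {0..1}"
      using frac_lt_1 less_imp_le by auto
    then obtain \<sigma> r1 where r1: "strict_mono (r1 :: nat \<Rightarrow> nat)" and \<sigma>: "((\<lambda>k. frac (s k)) \<circ> r1) \<longlonglongrightarrow> \<sigma>"
      using compact_imp_seq_compact[OF compact_Icc, of 0 "1 :: real"] unfolding seq_compact_def by metis
    obtain r2 V where r2: "strict_mono (r2 :: nat \<Rightarrow> nat)" and V: "\<And>t. V t \<in> Lp p"
      and lim: "\<And>t. (\<lambda>k. Lp_norm p (U (t + of_int \<lfloor>s (r1 (r2 k))\<rfloor>) - V t)) \<longlonglongrightarrow> 0"
        "\<And>t. (\<lambda>k. Lp_norm p (V (t - of_int \<lfloor>s (r1 (r2 k))\<rfloor>) - U t)) \<longlonglongrightarrow> 0"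
      using Lp.AA_subsequence[OF U, where s="\<lambda>k. of_int \<lfloor>s (r1 k)\<rfloor>"] by blast
    define r where "r = r1 \<circ> r2"
    have r: "strict_mono r"
      unfolding r_def using r1 r2 by (rule strict_mono_o)
    have frac_lim: "(\<lambda>k. frac (s (r k))) \<longlonglongrightarrow> \<sigma>"
      using LIMSEQ_subseq_LIMSEQ[OF \<sigma> r2] by (simp add: r_def o_def)
    \<comment> \<open>The floors turn \<open>U\<close> into \<open>V\<close>, and the fractional
      parts leave a translation by \<open>\<sigma>\<close> behind.\<close>
    define w where "w t = bochner_projection V (t + \<sigma>)" for t
    have "(\<lambda>k. Lp_norm p (bochner_projection U (t + s (r k)) - w t)) \<longlonglongrightarrow> 0" for t
    proof -
      have "(\<lambda>k. Lp_norm p (bochner_projection (\<lambda>x. U (x + of_int \<lfloor>s (r k)\<rfloor>)) (t + frac (s (r k))) -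
          bochner_projection V (t + \<sigma>))) \<longlonglongrightarrow> 0"
        using lim(1) frac_lim by (intro bochner_projection_tendsto p mem V tendsto_intros) (simp_all add: r_def)
      then show ?thesis
        by (simp add: bochner_projection_shift w_def frac_def)
    qed
    moreover have "(\<lambda>k. Lp_norm p (w (t - s (r k)) - bochner_projection U t)) \<longlonglongrightarrow> 0" for t
    proof -
      \<comment> \<open>On the way back the fractional parts cancel \<open>\<sigma>\<close> in the
        limit, and the floors return \<open>V\<close> to \<open>U\<close>.\<close>
      have "(\<lambda>k. t + \<sigma> - frac (s (r k))) \<longlonglongrightarrow> t + \<sigma> - \<sigma>"
        using frac_lim by (intro tendsto_intros)
      then have "(\<lambda>k. Lp_norm p (bochner_projection (\<lambda>x. V (x + of_int (- \<lfloor>s (r k)\<rfloor>))) (t + \<sigma> - frac (s (r k))) -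
          bochner_projection U t)) \<longlonglongrightarrow> 0"
        using lim(2) by (intro bochner_projection_tendsto p mem V) (simp_all add: r_def)
      then show ?thesis
        unfolding bochner_projection_shift by (simp add: w_def frac_def algebra_simps)
    qed
    moreover have "range w \<subseteq> Lp p"
      using bochner_projection_in_Lp[of p V, OF p V] by (auto simp: w_def)
    ultimately show ?thesis
      using r by blast
  qed
  then show ?thesis
    using continuous_map_bochner_projection[of p U, OF p mem] by (simp add: Lp.AA_iff)
qed

text \<open>One argument for all three cases: \<open>F\<close> is any subspace of BC stable under
  the projection, and \<open>X\<close> is the matching Stepanov space. Stability is what places
  \<open>LU\<close> in \<open>X\<close>, since \<open>B (LU)\<close> is the projection of
  \<open>U\<close>; \<open>B\<close> has bound 1 and \<open>L\<close> has bound 2.\<close>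

lemma Stepanov_decomposition:
  fixes F :: "(real \<Rightarrow> 'a::real_normed_vector ae01) set"
  assumes p: "1 \<le> p" and F: "real_vector.subspace F" "F \<subseteq> BC (Lp p) (Lp_norm p)"
    and proj: "\<And>U. U \<in> F \<Longrightarrow> bochner_projection U \<in> F"
    and X: "X = {u. in_Lp_loc p u \<and> bochner_transform u \<in> F}"
  shows "left_inverse X (Sp_norm p) F (sup_norm (Lp_norm p)) bochner_transform bochner_left_inverse \<and>
    closed_subspace F (sup_norm (Lp_norm p)) (bochner_transform ` X) \<and>
    closed_subspace F (sup_norm (Lp_norm p)) {V \<in> F. \<forall>n::int. V (of_int n) = 0} \<and>
    direct_sum F (bochner_transform ` X) {V \<in> F. \<forall>n::int. V (of_int n) = 0}"
proof -
  interpret Lp: normed_carrier "Lp p :: 'a ae01 set" "Lp_norm p"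
    by (rule normed_carrier_Lp[OF p])
  interpret F: normed_carrier F "sup_norm (Lp_norm p)"
    by (rule normed_carrier.normed_carrier_subset[OF Lp.normed_carrier_BC F])
  have mem: "U t \<in> Lp p" if "U \<in> F" for U t
    using subsetD[OF F(2) that] by (auto simp: Lp.BC_iff)
  have left: "left_inverse X (Sp_norm p) F (sup_norm (Lp_norm p)) bochner_transform bochner_left_inverse"
    unfolding left_inverse_def bounded_operator_def
  proof (intro conjI ballI allI)
    show "bochner_transform ` X \<subseteq> F"
      by (auto simp: X)
    show "\<exists>K. \<forall>u\<in>X. sup_norm (Lp_norm p) (bochner_transform u) \<le> K * Sp_norm p u"
      by (intro exI[of _ 1]) (simp add: Sp_norm_eq_sup_norm)
    show "bochner_left_inverse ` F \<subseteq> X"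
    proof (rule image_subsetI)
      fix U assume U: "U \<in> F"
      have "in_Lp_loc p (bochner_left_inverse U)"
        using mem[OF U] by (intro in_Lp_loc_left_inverse[OF p]) (simp add: Lp_def)
      then show "bochner_left_inverse U \<in> X"
        using proj[OF U] by (simp add: X bochner_projection_def)
    qed
    show "\<exists>K. \<forall>U\<in>F. Sp_norm p (bochner_left_inverse U) \<le> K * sup_norm (Lp_norm p) U"
      using BC_bochner_projection(2)[OF p] F(2)
      by (intro exI[of _ 2]) (auto simp: Sp_norm_eq_sup_norm bochner_projection_def)
  qed (rule bochner_transform_add bochner_transform_scaleR bochner_left_inverse_add
      bochner_left_inverse_scaleR bochner_left_inverse_transform)+
  have "0 \<le> Sp_norm p u" if "u \<in> X" for u
    unfolding Sp_norm_eq_sup_norm using that F(2) by (intro Lp.sup_norm_nonneg) (auto simp: X)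
  note F.left_inverse_decomposition[OF left this, unfolded bochner_left_inverse_eq_0_iff]
  with left show ?thesis by blast
qed

theorem theorem3p3:
  fixes p :: real
  assumes "1 \<le> p"
  shows
    "(left_inverse
        (BSp p :: 'a::banach aeR set) (Sp_norm p)
        (BC (Lp p) (Lp_norm p)) (sup_norm (Lp_norm p))
        bochner_transform bochner_left_inverse \<and>
      closed_subspace (BC (Lp p) (Lp_norm p)) (sup_norm (Lp_norm p))
        (bochner_transform ` (BSp p :: 'a aeR set)) \<and>
      closed_subspace (BC (Lp p) (Lp_norm p)) (sup_norm (Lp_norm p))
        {V \<in> BC (Lp p :: 'a ae01 set) (Lp_norm p). \<forall>n::int. V (of_int n) = 0} \<and>
      direct_sum (BC (Lp p) (Lp_norm p))
        (bochner_transform ` (BSp p :: 'a aeR set))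
        {V \<in> BC (Lp p) (Lp_norm p). \<forall>n::int. V (of_int n) = 0}) \<and>
     (left_inverse
        (Sp_aa p :: 'a aeR set) (Sp_norm p)
        (AA (Lp p) (Lp_norm p)) (sup_norm (Lp_norm p))
        bochner_transform bochner_left_inverse \<and>
      closed_subspace (AA (Lp p) (Lp_norm p)) (sup_norm (Lp_norm p))
        (bochner_transform ` (Sp_aa p :: 'a aeR set)) \<and>
      closed_subspace (AA (Lp p) (Lp_norm p)) (sup_norm (Lp_norm p))
        {V \<in> AA (Lp p :: 'a ae01 set) (Lp_norm p). \<forall>n::int. V (of_int n) = 0} \<and>
      direct_sum (AA (Lp p) (Lp_norm p))
        (bochner_transform ` (Sp_aa p :: 'a aeR set))
        {V \<in> AA (Lp p) (Lp_norm p). \<forall>n::int. V (of_int n) = 0}) \<and>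
     (left_inverse
        (Sp_ap p :: 'a aeR set) (Sp_norm p)
        (AP (Lp p) (Lp_norm p)) (sup_norm (Lp_norm p))
        bochner_transform bochner_left_inverse \<and>
      closed_subspace (AP (Lp p) (Lp_norm p)) (sup_norm (Lp_norm p))
        (bochner_transform ` (Sp_ap p :: 'a aeR set)) \<and>
      closed_subspace (AP (Lp p) (Lp_norm p)) (sup_norm (Lp_norm p))
        {V \<in> AP (Lp p :: 'a ae01 set) (Lp_norm p). \<forall>n::int. V (of_int n) = 0} \<and>
      direct_sum (AP (Lp p) (Lp_norm p))
        (bochner_transform ` (Sp_ap p :: 'a aeR set))
        {V \<in> AP (Lp p) (Lp_norm p). \<forall>n::int. V (of_int n) = 0})"
proof -
  interpret Lp: normed_carrier "Lp p :: 'a ae01 set" "Lp_norm p"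
    by (rule normed_carrier_Lp[OF assms])
  note BC = Stepanov_decomposition[OF assms normed_carrier.subspace[OF Lp.normed_carrier_BC]
      subset_refl BC_bochner_projection(1)[OF assms] BSp_def]
  note AA = Stepanov_decomposition[OF assms Lp.subspace_AA Lp.AA_subset_BC
      AA_bochner_projection[OF assms] Sp_aa_def]
  note AP = Stepanov_decomposition[OF assms Lp.subspace_AP Lp.AP_subset_BC
      AP_bochner_projection[OF assms] Sp_ap_def]
  show ?thesis
    by (rule conjI[OF BC conjI[OF AA AP]])
qed

end
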